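(* Let $c\in\mathbb{C}(t)$ with $c\notin\{0,1,t\}$, let $C$ be a homogeneous lift of $c$, set $F_1=F_{t_1,t_2}(C)/\gcd(F_{t_1,t_2}(C))$, $d=\deg F_1$, and $F_{n+1}=F_{t_1,t_2}(F_n)/t_2^2$ for all $n\ge1$, so that $\deg F_n=4^{n-1}d$. Then the sequence $\frac{1}{\deg F_n}\log\|F_n(t_1,t_2)\|$ converges locally uniformly on $\mathbb{C}^2\setminus\{(0,0)\}$, as $n\to\infty$, to a continuous plurisubharmonic function $G_C$.
   Context: For $(t_1,t_2),(z,w)\in\mathbb{C}^2$ let $F_{t_1,t_2}(z,w)=\big((t_1w^2-t_2z^2)^2,\;4t_2zw(w-z)(t_1w-t_2z)\big)$, a homogenization of the Lattès map $f_t(z)=\frac{(z^2-t)^2}{4z(z-1)(z-t)}$, $t=t_1/t_2$. A homogeneous lift of $c\in\mathbb{C}(t)$ is a pair $C=(c_1,c_2)$ of homogeneous polynomials in $(t_1,t_2)$ of the same degree with no common factor such that $c(t)=c_1(t,1)/c_2(t,1)$. For a pair $F=(P,Q)$ of homogeneous polynomials in $(t_1,t_2)$ of the same degree, $\deg F$ denotes this degree and $\gcd(F)$ the gcd of $P$ and $Q$; $F_{t_1,t_2}(F)$ means substituting $(z,w)=(P,Q)$. The norm is $\|(z,w)\|=\max\{|z|,|w|\}$. *)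

theory Defs
  imports "HOL-Analysis.Analysis"
    "HOL-Computational_Algebra.Polynomial_Factorial"
    "HOL-Computational_Algebra.Fraction_Field"
    "HOL-Computational_Algebra.Field_as_Ring"
begin

text \<open>Bivariate polynomials in (t1,t2) are modelled as complex poly poly:
  an element P is a polynomial in t2 whose coefficients are polynomials in t1,
  i.e. P = sum over j of (coeff P j)(t1) * t2^j.\<close>

type_synonym bipoly = "complex poly poly"

definition var_t1 :: bipoly where "var_t1 = [:[:0, 1:]:]"
definition var_t2 :: bipoly where "var_t2 = [:0, 1:]"

definition eval2 :: "bipoly \<Rightarrow> complex \<Rightarrow> complex \<Rightarrow> complex" where
  "eval2 P a b = poly (poly P [:b:]) a"

definition dehom :: "bipoly \<Rightarrow> complex poly" where
  "dehom P = poly P [:1:]"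

definition homogeneous :: "nat \<Rightarrow> bipoly \<Rightarrow> bool" where
  "homogeneous k P \<longleftrightarrow> (\<forall>i j. coeff (coeff P j) i \<noteq> 0 \<longrightarrow> i + j = k)"

definition total_degree :: "bipoly \<Rightarrow> nat" where
  "total_degree P = Max (insert 0 {i + j | i j. coeff (coeff P j) i \<noteq> 0})"

definition pair_deg :: "bipoly \<times> bipoly \<Rightarrow> nat" where
  "pair_deg F = max (total_degree (fst F)) (total_degree (snd F))"

definition pair_gcd :: "bipoly \<times> bipoly \<Rightarrow> bipoly" where
  "pair_gcd F = gcd (fst F) (snd F)"

definition homogeneous_lift :: "complex poly fract \<Rightarrow> bipoly \<times> bipoly \<Rightarrow> bool" where
  "homogeneous_lift c C \<longleftrightarrow>
     (\<exists>k. homogeneous k (fst C) \<and> homogeneous k (snd C)) \<and>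
     coprime (fst C) (snd C) \<and>
     dehom (snd C) \<noteq> 0 \<and>
     c = Fract (dehom (fst C)) (dehom (snd C))"

definition lattes_F :: "bipoly \<times> bipoly \<Rightarrow> bipoly \<times> bipoly" where
  "lattes_F F = (let z = fst F; w = snd F in
     ((var_t1 * w^2 - var_t2 * z^2)^2,
      4 * var_t2 * z * w * (w - z) * (var_t1 * w - var_t2 * z)))"

text \<open>lattes_seq C n is F_{n+1} of the paper (indexing shifted to start at 0).\<close>
fun lattes_seq :: "bipoly \<times> bipoly \<Rightarrow> nat \<Rightarrow> bipoly \<times> bipoly" where
  "lattes_seq C 0 = (let G = lattes_F C; g = pair_gcd G in (fst G div g, snd G div g))"
| "lattes_seq C (Suc n) = (let G = lattes_F (lattes_seq C n) in
       (fst G div var_t2^2, snd G div var_t2^2))"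

definition maxnorm :: "complex \<times> complex \<Rightarrow> real" where
  "maxnorm x = max (cmod (fst x)) (cmod (snd x))"

definition pair_eval :: "bipoly \<times> bipoly \<Rightarrow> complex \<times> complex \<Rightarrow> complex \<times> complex" where
  "pair_eval F x = (eval2 (fst F) (fst x) (snd x), eval2 (snd F) (fst x) (snd x))"

definition locally_uniform_limit ::
  "('a::topological_space) set \<Rightarrow> (nat \<Rightarrow> 'a \<Rightarrow> real) \<Rightarrow> ('a \<Rightarrow> real) \<Rightarrow> bool" where
  "locally_uniform_limit U f g \<longleftrightarrow>
     (\<forall>x\<in>U. \<exists>V. open V \<and> x \<in> V \<and> uniform_limit (V \<inter> U) f g sequentially)"

definition upper_semicontinuous_on :: "('a::topological_space) set \<Rightarrow> ('a \<Rightarrow> real) \<Rightarrow> bool" where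
  "upper_semicontinuous_on U u \<longleftrightarrow>
     (\<forall>x\<in>U. \<forall>a. u x < a \<longrightarrow> eventually (\<lambda>y. u y < a) (at x within U))"

definition plurisubharmonic_on :: "(complex \<times> complex) set \<Rightarrow> (complex \<times> complex \<Rightarrow> real) \<Rightarrow> bool" where
  "plurisubharmonic_on U u \<longleftrightarrow>
     open U \<and> upper_semicontinuous_on U u \<and>
     (\<forall>a b. (\<forall>\<zeta>::complex. cmod \<zeta> \<le> 1 \<longrightarrow> a + (\<zeta> * fst b, \<zeta> * snd b) \<in> U) \<longrightarrow>
        u a \<le> (1 / (2 * pi)) *
          integral {0..2*pi} (\<lambda>\<theta>. u (a + (cis \<theta> * fst b, cis \<theta> * snd b))))"

end

theory Submission
  imports Defs "HOL-Complex_Analysis.Complex_Analysis"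
begin

text \<open>
  Dividing by \<open>t2\<^sup>2\<close> turns the recursion into the iteration of the map \<open>lattes_map t\<close> of degree 4
  with \<open>t = t1 / t2\<close>. Away from \<open>t = 0, 1, \<infinity>\<close> the quantity \<open>ln \<parallel>lattes_map t X\<parallel> - 4 ln \<parallel>X\<parallel>\<close> is
  locally bounded, so the normalised logarithms converge like a geometric series. At \<open>t = 0\<close> the map
  degenerates exactly in the direction \<open>z = 0\<close>. Removing the gcd ensures that \<open>F\<^sub>1\<close> avoids this
  direction over \<open>t = 0\<close>, and although its orbit may be attracted to \<open>z = 0\<close>, the distance to \<open>z = 0\<close>
  is at worst squared in each step. Hence the \<open>n\<close>-th loss is \<open>O(2 ^ n)\<close>, still summable
  against \<open>4 ^ n\<close>. The symmetries \<open>(t, z) \<mapsto> (1 - t, 1 - z)\<close> and \<open>(t, z) \<mapsto> (1 / t, z / t)\<close> carry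
  this over to \<open>t = 1\<close> and \<open>t = \<infinity>\<close>. The limit is plurisubharmonic because every
  \<open>ln \<parallel>F\<^sub>n\<parallel>\<close> satisfies the sub-mean inequality.
\<close>

text \<open>\<open>f_t\<close> is doubling in the x-coordinate of the Legendre curve y^2 =
  x(x-1)(x-t). This curve is singular exactly over t = 0, 1, infinity, whence the three bad
  parameters and the symmetries that permute them. Over t = 0 the node is x = 0:
  \<open>lattes_map 0\<close> kills the direction z = 0, and the map left after cancellation is x^2
  / (4(x-1)), which is superattracting at 0. The obstacle is uniformity. A neighbourhood of a point
  over t = 0 contains points with t = 0 and points with t small and nonzero; for the latter the
  first coordinate vanishes on the moving locus z^2 = t w^2. Hence |z| alone cannot measure the
  loss. \<open>depth\<close> compares |z|^2 with |t| |w|^2, never drops below |t|, and treats both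
  kinds of parameter in one estimate. Each division by t2^2 is exact because t2 divides the second
  coordinate. Writing that coordinate as t2 * e also provides, through t1 * e, coordinates that stay
  meaningful at t2 = 0.\<close>

subsection \<open>Homogeneous polynomials\<close>

text \<open>This is P(2 t1, 2 t2). Homogeneity of degree k becomes the eigenvector equation
  \<open>dilate P = 2 ^ k * P\<close>, so closure under products, differences and cofactors follows
  from algebraic rules for \<open>dilate\<close>. The base 2 works because its powers are
  distinct.\<close>

definition dilate :: "bipoly \<Rightarrow> bipoly" where
  "dilate P = map_poly (\<lambda>p. pcompose p [:0, 2:]) (pcompose P [:0, 2:])"

lemma coeff_dilate: "coeff (coeff (dilate P) j) i = 2 ^ (i + j) * coeff (coeff P j) i"
proof -
  have "coeff (dilate P) j = pcompose (2 ^ j * coeff P j) [:0, 2:]"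
    by (simp add: dilate_def coeff_map_poly coeff_pcompose_linear)
  moreover have "(2::complex poly) ^ j = [:2 ^ j:]"
    by (simp add: numeral_poly poly_const_pow)
  ultimately show ?thesis
    by (simp add: coeff_pcompose_linear power_add)
qed

lemma dilate_mult: "dilate (P * Q) = dilate P * dilate Q"
proof (intro poly_eqI)
  fix j i
  have *: "(2::complex) ^ (i + j) * (coeff (coeff P a) b * coeff (coeff Q (j - a)) (i - b)) =
    (2 ^ (b + a) * coeff (coeff P a) b) * (2 ^ (i - b + (j - a)) * coeff (coeff Q (j - a)) (i - b))"
    if "a \<le> j" "b \<le> i" for a b
  proof -
    have "i + j = (b + a) + (i - b + (j - a))" using that by simp
    then have "(2::complex) ^ (i + j) = 2 ^ (b + a) * 2 ^ (i - b + (j - a))"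
      by (metis power_add)
    then show ?thesis by simp
  qed
  show "coeff (coeff (dilate (P * Q)) j) i = coeff (coeff (dilate P * dilate Q) j) i"
    unfolding coeff_dilate by (simp add: coeff_mult coeff_sum sum_distrib_left coeff_dilate * del: power_add_numeral)
qed

lemma dilate_diff: "dilate (P - Q) = dilate P - dilate Q"
  by (intro poly_eqI) (simp add: coeff_dilate algebra_simps)

lemma coeff_coeff_two_power_mult: "coeff (coeff (2 ^ k * P) j) i = 2 ^ k * coeff (coeff P j) i"
  for P :: bipoly
proof -
  have "(2::bipoly) ^ k = [:[:2 ^ k:]:]"
    by (simp add: numeral_poly poly_const_pow)
  then show ?thesis by simp
qed

lemma two_power_eq_iff: "(2::complex) ^ m = 2 ^ n \<longleftrightarrow> m = n"
proof
  assume "(2::complex) ^ m = 2 ^ n"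
  then have "norm ((2::complex) ^ m) = norm ((2::complex) ^ n)" by simp
  then show "m = n" by (simp add: norm_power)
qed auto

lemma homogeneous_iff_dilate: "homogeneous k P \<longleftrightarrow> dilate P = 2 ^ k * P"
proof -
  have "homogeneous k P \<longleftrightarrow>
    (\<forall>j i. coeff (coeff (dilate P) j) i = coeff (coeff (2 ^ k * P) j) i)"
    unfolding homogeneous_def coeff_dilate coeff_coeff_two_power_mult mult_cancel_right
    by (metis two_power_eq_iff)
  then show ?thesis by (metis poly_eqI)
qed

lemma homogeneous_mult: "homogeneous j P \<Longrightarrow> homogeneous k Q \<Longrightarrow> homogeneous (j + k) (P * Q)"
  by (simp add: homogeneous_iff_dilate dilate_mult power_add ac_simps)

lemma homogeneous_diff: "homogeneous k P \<Longrightarrow> homogeneous k Q \<Longrightarrow> homogeneous k (P - Q)"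
  by (simp add: homogeneous_iff_dilate dilate_diff algebra_simps)

lemma homogeneous_power2: "homogeneous k P \<Longrightarrow> homogeneous (2 * k) (P\<^sup>2)"
  using homogeneous_mult[of k P k P] by (simp add: power2_eq_square mult_2)

lemma homogeneous_const [simp]: "homogeneous 0 [:[:a:]:]"
  by (auto simp: homogeneous_def coeff_pCons split: nat.splits)

lemma homogeneous_numeral [simp]: "homogeneous 0 (numeral n)"
  by (simp add: numeral_poly)

lemma homogeneous_var_t1 [simp]: "homogeneous 1 var_t1"
  by (auto simp: homogeneous_def var_t1_def coeff_pCons split: nat.splits)

lemma homogeneous_var_t2 [simp]: "homogeneous 1 var_t2"
  by (auto simp: homogeneous_def var_t2_def coeff_pCons split: nat.splits)

text \<open>Cancelling \<open>g\<close> leaves \<open>2 ^ m * dilate P = 2 ^ k * P\<close>. The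
  truncated \<open>k - m\<close> is harmless: a nonzero coefficient of \<open>P\<close> forces
  \<open>m + (i + j) = k\<close>, and the zero polynomial is homogeneous of every degree.\<close>

lemma homogeneous_cofactor:
  assumes "homogeneous m g" and "homogeneous k (g * P)" and "g \<noteq> 0"
  shows "homogeneous (k - m) P"
proof -
  have "g * (2 ^ m * dilate P) = g * (2 ^ k * P)"
    using assms by (simp add: homogeneous_iff_dilate dilate_mult ac_simps)
  then have "2 ^ m * dilate P = 2 ^ k * P" using \<open>g \<noteq> 0\<close> by simp
  then have eq: "2 ^ m * (2 ^ (i + j) * coeff (coeff P j) i) = 2 ^ k * coeff (coeff P j) i" for i j
    by (metis coeff_coeff_two_power_mult coeff_dilate)
  show ?thesis unfolding homogeneous_def
  proof (intro allI impI)
    fix i j assume "coeff (coeff P j) i \<noteq> 0"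
    then have "(2::complex) ^ (m + (i + j)) = 2 ^ k"
      using eq[of i j] by (simp add: power_add)
    then have "m + (i + j) = k" by (simp only: two_power_eq_iff)
    then show "i + j = k - m" by simp
  qed
qed

lemma total_degree_homogeneous:
  assumes "homogeneous k P" and "P \<noteq> 0"
  shows "total_degree P = k"
proof -
  obtain i j where "coeff (coeff P j) i \<noteq> 0"
    using \<open>P \<noteq> 0\<close> by (metis leading_coeff_neq_0)
  then have "{i + j |i j. coeff (coeff P j) i \<noteq> 0} = {k}"
    using assms(1) unfolding homogeneous_def by blast
  then show ?thesis by (simp add: total_degree_def)
qed

lemma total_degree_0: "total_degree 0 = 0"
  by (simp add: total_degree_def)

lemma degree_dilate_bipoly: "degree (dilate P) = degree P"
proof -
  have "coeff (dilate P) j = 0 \<longleftrightarrow> coeff P j = 0" for j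
    by (simp add: poly_eq_iff coeff_dilate)
  then show ?thesis by (simp add: degree_def)
qed

lemma degree_coeff_dilate: "degree (coeff (dilate P) j) = degree (coeff P j)"
  by (simp add: degree_def coeff_dilate)

lemma dilate_eq_0_iff: "dilate P = 0 \<longleftrightarrow> P = 0"
  by (simp add: poly_eq_iff coeff_dilate)

text \<open>The dilation of the gcd again divides both polynomials, hence is a constant multiple of it.\<close>
lemma homogeneous_gcd:
  fixes P Q :: bipoly
  assumes "homogeneous k P" and "homogeneous k Q" and "P \<noteq> 0"
  shows "\<exists>m. homogeneous m (gcd P Q)"
proof -
  let ?g = "gcd P Q"
  have unit: "is_unit ((2::bipoly) ^ k)"
  proof -
    have "(2::bipoly) ^ k * [:[:1 / 2 ^ k:]:] = 1"
      by (simp add: numeral_poly poly_const_pow one_pCons)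
    then show ?thesis by (metis dvd_triv_left)
  qed
  have "dilate ?g dvd dilate P" "dilate ?g dvd dilate Q"
    by (metis dilate_mult dvd_def gcd_dvd1) (metis dilate_mult dvd_def gcd_dvd2)
  then have "dilate ?g dvd P" "dilate ?g dvd Q"
    using assms unit by (simp_all add: homogeneous_iff_dilate dvd_mult_unit_iff')
  then obtain h where h: "?g = dilate ?g * h"
    by (metis dvd_def gcd_greatest)
  have g0: "?g \<noteq> 0" using \<open>P \<noteq> 0\<close> by simp
  then have h0: "h \<noteq> 0" using h by (metis mult_zero_right)
  \<comment> \<open>Dilation preserves the degree in t2 and the degree in t1 of each coefficient.
    Comparing the first makes \<open>h\<close> free of t2; comparing the second at the leading
    coefficient makes it a number \<open>e\<close>.\<close>
  have "degree ?g = degree ?g + degree h"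
    using h h0 g0 dilate_eq_0_iff degree_mult_eq degree_dilate_bipoly by metis
  then obtain p where p: "h = [:p:]"
    by (metis add_cancel_right_right degree_eq_zeroE)
  have cf: "coeff ?g j = coeff (dilate ?g) j * p" for j
    using h p by (metis coeff_mult_0 coeff_smult mult.commute mult_smult_right mult.right_neutral smult_one)
  have lc: "coeff ?g (degree ?g) \<noteq> 0" using g0 by simp
  have p0: "p \<noteq> 0" using h0 p by auto
  have "degree (coeff ?g (degree ?g)) = degree (coeff ?g (degree ?g)) + degree p"
    using lc p0 cf degree_mult_eq degree_coeff_dilate by (metis mult_zero_left)
  then obtain e where e: "p = [:e:]"
    by (metis add_cancel_right_right degree_eq_zeroE)
  have ce: "coeff (coeff ?g j) i = 2 ^ (i + j) * coeff (coeff ?g j) i * e" for i j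
    using cf[of j] e by (metis coeff_dilate coeff_pCons_0 coeff_smult mult.commute mult_smult_right mult.right_neutral smult_one)
  \<comment> \<open>Every monomial that occurs satisfies \<open>2 ^ (i + j) * e = 1\<close>, so
    \<open>i + j\<close> is the same for all of them; \<open>?m\<close> is its value at the leading
    monomial.\<close>
  let ?m = "degree (coeff ?g (degree ?g)) + degree ?g"
  have e1: "2 ^ (i + j) * e = 1" if "coeff (coeff ?g j) i \<noteq> 0" for i j
    using ce[of j i] that by (simp add: ac_simps)
  have "homogeneous ?m ?g"
    unfolding homogeneous_def
  proof (intro allI impI)
    fix i j assume "coeff (coeff ?g j) i \<noteq> 0"
    then have "2 ^ (i + j) * e = 2 ^ ?m * e"
      using e1 lc by simp
    moreover have "e \<noteq> 0" using p0 e by auto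
    ultimately have "(2::complex) ^ (i + j) = 2 ^ ?m" by simp
    then show "i + j = ?m" by (simp only: two_power_eq_iff)
  qed
  then show ?thesis ..
qed

section \<open>Evaluation, linear factors and common zeros of homogeneous polynomials\<close>

lemma poly_poly_cong: "poly r x = poly s x \<Longrightarrow> poly (poly P r) x = poly (poly P s) x"
  for P :: "'a::comm_ring_1 poly poly"
  by (induction P) auto

lemma eval2_altdef: "eval2 P a b = (\<Sum>j\<le>degree P. poly (coeff P j) a * b ^ j)"
  unfolding eval2_def by (simp add: poly_altdef[of P] poly_sum)

lemma eval2_homogeneous:
  assumes "homogeneous k P"
  shows "eval2 P (l * a) (l * b) = l ^ k * eval2 P a b"
proof -
  have "poly (coeff P j) (l * a) * (l * b) ^ j = l ^ k * (poly (coeff P j) a * b ^ j)" for j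
  proof -
    have "coeff (coeff P j) i * (l * a) ^ i * (l * b) ^ j = l ^ k * (coeff (coeff P j) i * a ^ i * b ^ j)" for i
    proof (cases "coeff (coeff P j) i = 0")
      case False
      then have "k = i + j" using assms by (simp add: homogeneous_def)
      then show ?thesis by (simp add: power_mult_distrib power_add)
    qed simp
    then show ?thesis
      unfolding poly_altdef sum_distrib_left sum_distrib_right by (intro sum.cong refl) (simp add: mult.assoc)
  qed
  then show ?thesis by (simp add: eval2_altdef sum_distrib_left)
qed

lemma eval2_simps [simp]:
  "eval2 (P + Q) a b = eval2 P a b + eval2 Q a b"
  "eval2 (P - Q) a b = eval2 P a b - eval2 Q a b"
  "eval2 (P * Q) a b = eval2 P a b * eval2 Q a b"
  "eval2 (P ^ n) a b = eval2 P a b ^ n"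
  "eval2 (numeral m) a b = numeral m"
  "eval2 var_t1 a b = a"
  "eval2 var_t2 a b = b"
  by (simp_all add: eval2_def var_t1_def var_t2_def poly_power)

text \<open>The divisor is t2 - s t1. By homogeneity one zero spreads over the whole line t2 = s t1,
  so substituting s t1 for t2 gives the zero polynomial, and the factor theorem over polynomials in
  t1 applies.\<close>

lemma line_dvd_homogeneous:
  assumes "homogeneous k P" and "eval2 P 1 s = 0"
  shows "[:- [:0, s:], 1:] dvd P"
proof -
  have "poly (poly P [:0, s:]) x = 0" for x
  proof -
    have "poly (poly P [:0, s:]) x = poly (poly P [:s * x:]) x"
      by (rule poly_poly_cong) simp
    also have "\<dots> = eval2 P (x * 1) (x * s)" by (simp add: eval2_def mult.commute)
    also have "\<dots> = 0" by (simp only: eval2_homogeneous[OF assms(1)] assms(2)) simp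
    finally show ?thesis .
  qed
  then have "poly P [:0, s:] = 0" by (metis poly_all_0_iff_0)
  then show ?thesis by (simp only: poly_eq_0_iff_dvd)
qed

text \<open>The line t1 = 0 is not a graph over t1, so the factor theorem in t2 does not reach it.
  Instead all coefficients, as polynomials in t1, are shown to vanish at 0.\<close>

lemma var_t1_dvd_homogeneous:
  assumes "homogeneous k P" and "eval2 P 0 1 = 0"
  shows "var_t1 dvd P"
proof -
  have "poly (map_poly (\<lambda>p. poly p 0) P) y = 0" for y
  proof -
    have "poly (map_poly (\<lambda>p. poly p 0) P) y = eval2 P (y * 0) (y * 1)"
      by (induction P) (auto simp: eval2_def map_poly_pCons)
    also have "\<dots> = 0" by (simp only: eval2_homogeneous[OF assms(1)] assms(2)) simp
    finally show ?thesis .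
  qed
  then have "map_poly (\<lambda>p. poly p 0) P = 0" by (metis poly_all_0_iff_0)
  then have "poly (coeff P j) 0 = 0" for j
    by (metis coeff_0 coeff_map_poly poly_0)
  then show ?thesis
    unfolding var_t1_def const_poly_dvd_iff by (simp add: dvd_iff_poly_eq_0)
qed

lemma prime_elem_linear_poly: "prime_elem [:- a, 1:]" for a :: "'a::idom"
  by (rule prime_elemI) (auto simp: is_unit_iff_degree poly_eq_0_iff_dvd[symmetric] dest: is_unit_polyE)

lemma prime_elem_vars: "prime_elem var_t1" "prime_elem var_t2" "prime_elem (var_t2 - var_t1)"
proof -
  have "prime_elem [:0, 1::complex:]" using prime_elem_linear_poly[of "0::complex"] by simp
  then show "prime_elem var_t1" unfolding var_t1_def by (rule lift_prime_elem_poly)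
  show "prime_elem var_t2" using prime_elem_linear_poly[of "0::complex poly"] by (simp add: var_t2_def)
  show "prime_elem (var_t2 - var_t1)"
    using prime_elem_linear_poly[of "[:0, 1::complex:]"] by (simp add: var_t2_def var_t1_def)
qed

text \<open>A common zero (a, b) would produce a common linear factor: t1 if a = 0, and t2 - (b/a)
  t1 otherwise.\<close>

lemma coprime_homogeneous_no_common_zero:
  assumes "homogeneous k P" and "homogeneous k Q" and "coprime P Q" and "(a, b) \<noteq> (0, 0)"
  shows "eval2 P a b \<noteq> 0 \<or> eval2 Q a b \<noteq> 0"
proof (rule ccontr)
  assume "\<not> ?thesis"
  then have z: "eval2 P a b = 0" "eval2 Q a b = 0" by auto
  show False
  proof (cases "a = 0")
    case True
    then have "b \<noteq> 0" using assms(4) by simp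
    then have "eval2 P 0 1 = 0" "eval2 Q 0 1 = 0"
      using eval2_homogeneous[OF assms(1), of b 0 1] eval2_homogeneous[OF assms(2), of b 0 1] z True
      by auto
    then have "var_t1 dvd P" "var_t1 dvd Q"
      using assms var_t1_dvd_homogeneous by blast+
    then show False
      using prime_elem_vars(1) assms(3) by (meson coprime_common_divisor prime_elem_not_unit)
  next
    case False
    then have "eval2 P 1 (b / a) = 0" "eval2 Q 1 (b / a) = 0"
      using eval2_homogeneous[OF assms(1), of a 1 "b / a"] eval2_homogeneous[OF assms(2), of a 1 "b / a"] z
      by auto
    then show False
      using line_dvd_homogeneous assms prime_elem_linear_poly
      by (meson coprime_common_divisor prime_elem_not_unit)
  qed
qed

subsection \<open>The reduced lift\<close>

lemma prime_elem_power_dvd_cofactor: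
  fixes L g w :: "'a::idom"
  assumes "prime_elem L" and "\<not> L dvd w" and "L ^ n dvd g * w"
  shows "L ^ n dvd g"
  using assms(3)
proof (induction n arbitrary: g)
  case (Suc n)
  then have "L dvd g * w" using dvd_mult_left[of L "L ^ n" "g * w"] by simp
  then obtain h where h: "g = L * h" using assms prime_elem_dvd_mult_iff by blast
  have "L \<noteq> 0" using assms(1) by auto
  then have "L ^ n dvd h * w" using Suc.prems by (simp add: h mult.assoc)
  then have "L ^ n dvd h" by (rule Suc.IH)
  then show ?case unfolding h power_Suc by (intro mult_dvd_mono dvd_refl)
qed simp

text \<open>A comparison of orders at L, kept abstract so as to serve both t1 and t2 - t1. If L
  divided z, it would divide c1; then L^2 divides g w, hence g. But g z is L^2 times a square prime
  to L, because L does not divide c2, so nothing of L is left for z.\<close>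

lemma prime_not_dvd_reduced_lattes:
  fixes L S c1 c2 g z w :: "'a::idom"
  assumes L: "prime_elem L" "\<not> L dvd S"
    and z: "g * z = (L * c2\<^sup>2 - S * c1\<^sup>2)\<^sup>2"
    and w: "g * w = 4 * S * c1 * c2 * (c2 - c1) * (L * c2 - S * c1)"
    and c: "\<not> (L dvd c1 \<and> L dvd c2)" and zw: "\<not> (L dvd z \<and> L dvd w)"
  shows "\<not> L dvd z"
proof
  assume Lz: "L dvd z"
  then have "\<not> L dvd w" using zw by blast
  have "L dvd (L * c2\<^sup>2 - S * c1\<^sup>2)\<^sup>2" using Lz unfolding z[symmetric] by simp
  then have "L dvd L * c2\<^sup>2 - S * c1\<^sup>2" using L prime_elem_dvd_power by blast
  then have "L dvd S * c1\<^sup>2" using dvd_diff_right_iff[of L "L * c2\<^sup>2" "S * c1\<^sup>2"] by simp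
  then have "L dvd c1" using L prime_elem_dvd_mult_iff prime_elem_dvd_power by blast
  then obtain e where e: "c1 = L * e" by blast
  have "L\<^sup>2 * (4 * S * e * c2 * (c2 - c1) * (c2 - S * e)) = g * w"
    unfolding w e by algebra
  then have "L\<^sup>2 dvd g * w" by (rule dvdI[OF sym])
  then have "L\<^sup>2 dvd g" using L \<open>\<not> L dvd w\<close> prime_elem_power_dvd_cofactor by blast
  then obtain g' where g': "g = L\<^sup>2 * g'" by blast
  have "L\<^sup>2 * (g' * z) = g * z" by (simp only: g' mult.assoc)
  also have "\<dots> = L\<^sup>2 * (c2\<^sup>2 - S * L * e\<^sup>2)\<^sup>2" unfolding z e by algebra
  finally have g'z: "g' * z = (c2\<^sup>2 - S * L * e\<^sup>2)\<^sup>2" using L(1) by simp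
  have "L dvd (c2\<^sup>2 - S * L * e\<^sup>2)\<^sup>2" using Lz unfolding g'z[symmetric] by simp
  then have "L dvd c2\<^sup>2 - S * L * e\<^sup>2" using L(1) prime_elem_dvd_power by blast
  then have "L dvd c2\<^sup>2" using dvd_diff_left_iff[of L "S * L * e\<^sup>2" "c2\<^sup>2"] by simp
  then show False using L c \<open>L dvd c1\<close> prime_elem_dvd_power by blast
qed

text \<open>The case of t = infinity, with L = t2 and S = t1. If L does not divide c2, then g z is
  prime to L while g w is not. If L divides c2, then g z has order exactly 2 at L and g w has order
  at least 3. Either way w keeps a factor L after reduction; this starts the exact divisions by
  t2^2.\<close>

lemma prime_dvd_reduced_lattes_snd:
  fixes L S c1 c2 g z w :: "'a::idom"
  assumes L: "prime_elem L" "\<not> L dvd S"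
    and z: "g * z = (S * c2\<^sup>2 - L * c1\<^sup>2)\<^sup>2"
    and w: "g * w = 4 * L * c1 * c2 * (c2 - c1) * (S * c2 - L * c1)"
    and c: "\<not> (L dvd c1 \<and> L dvd c2)" and zw: "\<not> (L dvd z \<and> L dvd w)"
  shows "L dvd w \<and> \<not> L dvd z"
proof -
  have "L dvd w"
  proof (rule ccontr)
    assume nw: "\<not> L dvd w"
    show False
    proof (cases "L dvd c2")
      case False
      have "L dvd g * w" unfolding w by simp
      then have "L dvd g" using L nw prime_elem_dvd_mult_iff by blast
      then have "L dvd (S * c2\<^sup>2 - L * c1\<^sup>2)\<^sup>2" unfolding z[symmetric] by simp
      then have "L dvd S * c2\<^sup>2 - L * c1\<^sup>2" using L prime_elem_dvd_power by blast
      then have "L dvd S * c2\<^sup>2" using dvd_diff_left_iff[of L "L * c1\<^sup>2" "S * c2\<^sup>2"] by simp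
      then show False using L False prime_elem_dvd_mult_iff prime_elem_dvd_power by blast
    next
      case True
      then obtain e where e: "c2 = L * e" by blast
      have "L ^ 3 * (4 * c1 * e * (c2 - c1) * (S * e - c1)) = g * w"
        unfolding w e by algebra
      then have "L ^ 3 dvd g * w" by (rule dvdI[OF sym])
      then have "L ^ 3 dvd g" using L nw prime_elem_power_dvd_cofactor by blast
      then obtain g' where g': "g = L ^ 3 * g'" by blast
      have "L\<^sup>2 * (L * (g' * z)) = g * z" unfolding g' by algebra
      also have "\<dots> = L\<^sup>2 * (S * L * e\<^sup>2 - c1\<^sup>2)\<^sup>2" unfolding z e by algebra
      finally have "L * (g' * z) = (S * L * e\<^sup>2 - c1\<^sup>2)\<^sup>2" using L(1) by simp
      then have "L dvd (S * L * e\<^sup>2 - c1\<^sup>2)\<^sup>2" by (rule dvdI[OF sym])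
      then have "L dvd S * L * e\<^sup>2 - c1\<^sup>2" using L(1) prime_elem_dvd_power by blast
      then have "L dvd c1\<^sup>2" using dvd_diff_right_iff[of L "S * L * e\<^sup>2" "c1\<^sup>2"] by simp
      then show False using L c True prime_elem_dvd_power by blast
    qed
  qed
  with zw show ?thesis by blast
qed

lemma not_dvd_vars: "\<not> var_t1 dvd var_t2" "\<not> var_t2 dvd var_t1" "\<not> var_t2 - var_t1 dvd var_t2"
proof -
  have *: "eval2 P a b = 0 \<Longrightarrow> P dvd Q \<Longrightarrow> eval2 Q a b = 0" for P Q a b
    by auto
  show "\<not> var_t1 dvd var_t2" using *[of var_t1 0 1 var_t2] by auto
  show "\<not> var_t2 dvd var_t1" using *[of var_t2 1 0 var_t1] by auto
  show "\<not> var_t2 - var_t1 dvd var_t2" using *[of "var_t2 - var_t1" 1 1 var_t2] by auto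
qed

lemma homogeneous_lattes_F:
  assumes "homogeneous k (fst F)" and "homogeneous k (snd F)"
  shows "homogeneous (4 * k + 2) (fst (lattes_F F))" "homogeneous (4 * k + 2) (snd (lattes_F F))"
proof -
  have "homogeneous (2 * (1 + 2 * k)) (fst (lattes_F F))"
    unfolding lattes_F_def Let_def fst_conv
    by (intro homogeneous_power2 homogeneous_diff homogeneous_mult homogeneous_var_t1 homogeneous_var_t2 assms)
  then show "homogeneous (4 * k + 2) (fst (lattes_F F))" by (simp add: algebra_simps)
  have "homogeneous (0 + 1 + k + k + k + (1 + k)) (snd (lattes_F F))"
    unfolding lattes_F_def Let_def snd_conv
    by (intro homogeneous_diff homogeneous_mult homogeneous_var_t1 homogeneous_var_t2 homogeneous_numeral assms)
  moreover have "0 + 1 + k + k + k + (1 + k) = 4 * k + 2" by simp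
  ultimately show "homogeneous (4 * k + 2) (snd (lattes_F F))" by metis
qed

lemma dehom_simps:
  "dehom (P * Q) = dehom P * dehom Q" "dehom var_t1 = [:0, 1:]" "dehom var_t2 = 1" "dehom 0 = 0"
  by (simp_all add: dehom_def var_t1_def var_t2_def one_pCons)

text \<open>The factors of the second coordinate correspond to the 2-torsion values 0, infinity, 1
  and t of c. The value infinity is excluded by \<open>dehom (snd C) \<noteq> 0\<close>, the others
  by assumption.\<close>

lemma homogeneous_lift_nondegenerate:
  assumes "c \<noteq> 0" and "c \<noteq> 1" and "c \<noteq> Fract [:0, 1:] 1" and "homogeneous_lift c C"
  shows "snd (lattes_F C) \<noteq> 0"
proof -
  obtain c1 c2 where C: "C = (c1, c2)" by (cases C)
  have d: "dehom c2 \<noteq> 0" "c = Fract (dehom c1) (dehom c2)"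
    using assms(4) by (auto simp: homogeneous_lift_def C)
  have "c1 \<noteq> 0"
    using d assms(1) by (auto simp: dehom_simps fract_collapse)
  moreover have "c2 \<noteq> 0" using d(1) by (auto simp: dehom_simps)
  moreover have "c2 - c1 \<noteq> 0"
  proof
    assume "c2 - c1 = 0"
    then have "c = 1" using d by (simp add: One_fract_def eq_fract)
    then show False using assms(2) by contradiction
  qed
  moreover have "var_t1 * c2 - var_t2 * c1 \<noteq> 0"
  proof
    assume "var_t1 * c2 - var_t2 * c1 = 0"
    then have "dehom (var_t1 * c2) = dehom (var_t2 * c1)" by simp
    then have "[:0, 1:] * dehom c2 = dehom c1" by (simp only: dehom_simps) simp
    then have "c = Fract [:0, 1:] 1" using d by (simp add: eq_fract)
    then show False using assms(3) by contradiction
  qed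
  moreover have "var_t2 \<noteq> 0" by (simp add: var_t2_def)
  moreover have "(4::bipoly) \<noteq> 0" by simp
  ultimately show ?thesis
    unfolding lattes_F_def C Let_def fst_conv snd_conv mult_eq_0_iff by blast
qed

text \<open>The four divisibility statements are the local conditions on the reduced pair over the
  bad parameters: z \<noteq> 0 over t = 0, z \<noteq> w over t = 1, and w = 0, z \<noteq> 0 over t =
  infinity.\<close>

lemma lattes_seq_0_properties:
  assumes "c \<noteq> 0" and "c \<noteq> 1" and "c \<noteq> Fract [:0, 1:] 1" and "homogeneous_lift c C"
  obtains d z w where "lattes_seq C 0 = (z, w)" "homogeneous d z" "homogeneous d w" "coprime z w" "0 < d"
    "\<not> var_t1 dvd z" "\<not> var_t2 - var_t1 dvd w - z" "var_t2 dvd w" "\<not> var_t2 dvd z"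
proof -
  obtain c1 c2 where C: "C = (c1, c2)" by (cases C)
  obtain k where k: "homogeneous k c1" "homogeneous k c2" and cop: "coprime c1 c2"
    using assms(4) by (auto simp: homogeneous_lift_def C)
  define g where "g = pair_gcd (lattes_F C)"
  define z where "z = fst (lattes_seq C 0)"
  define w where "w = snd (lattes_seq C 0)"
  have w0: "snd (lattes_F C) \<noteq> 0" using assms by (rule homogeneous_lift_nondegenerate)
  then have g0: "g \<noteq> 0" by (simp add: g_def pair_gcd_def)
  have gz: "g * z = fst (lattes_F C)" and gw: "g * w = snd (lattes_F C)"
    by (simp_all add: z_def w_def g_def Let_def pair_gcd_def)
  have co: "coprime z w"
    using w0 by (simp add: z_def w_def Let_def pair_gcd_def div_gcd_coprime)
  have hF: "homogeneous (4 * k + 2) (g * z)" "homogeneous (4 * k + 2) (g * w)"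
    unfolding gz gw using k homogeneous_lattes_F[of k C] by (simp_all only: C fst_conv snd_conv)
  obtain m where m: "homogeneous m g"
    using homogeneous_gcd[OF hF(2)[unfolded gw] hF(1)[unfolded gz] w0]
    unfolding g_def pair_gcd_def gcd.commute[of "fst (lattes_F C)"] by blast
  have "w \<noteq> 0" using w0 gw by auto
  define d where "d = 4 * k + 2 - m"
  have hz: "homogeneous d z" and hw: "homogeneous d w"
    using homogeneous_cofactor m hF g0 by (auto simp: d_def)
  have gz': "g * z = (var_t1 * c2\<^sup>2 - var_t2 * c1\<^sup>2)\<^sup>2"
    and gw': "g * w = 4 * var_t2 * c1 * c2 * (c2 - c1) * (var_t1 * c2 - var_t2 * c1)"
    unfolding gz gw by (simp_all add: lattes_F_def C)
  have nd: "\<not> (L dvd c1 \<and> L dvd c2)" "\<not> (L dvd z \<and> L dvd w)" if "prime_elem L" for L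
    using that cop co by (meson coprime_common_divisor prime_elem_not_unit)+
  have 1: "\<not> var_t1 dvd z"
    using prime_not_dvd_reduced_lattes[OF prime_elem_vars(1) not_dvd_vars(1) gz' gw'] nd prime_elem_vars by blast
  have 2: "var_t2 dvd w \<and> \<not> var_t2 dvd z"
    using prime_dvd_reduced_lattes_snd[OF prime_elem_vars(2) not_dvd_vars(2) gz' gw'] nd prime_elem_vars by blast
  \<comment> \<open>The substitution \<open>(t, z) \<mapsto> (1 - t, 1 - z)\<close> exchanges the degenerate parameters \<open>0\<close> and \<open>1\<close>.\<close>
  have 3: "\<not> var_t2 - var_t1 dvd w - z"
  proof (rule prime_not_dvd_reduced_lattes[OF prime_elem_vars(3) not_dvd_vars(3)])
    \<comment> \<open>The cofactor is -g since the substitution negates the last factor of the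
      second coordinate and leaves the product of the others unchanged.\<close>
    have "- g * (w - z) = g * z - g * w" by (simp add: algebra_simps)
    then show "- g * (w - z) = ((var_t2 - var_t1) * c2\<^sup>2 - var_t2 * (c2 - c1)\<^sup>2)\<^sup>2"
      unfolding gz' gw' by (simp add: algebra_simps power2_eq_square)
    have "- g * w = - (g * w)" by simp
    then show "- g * w = 4 * var_t2 * (c2 - c1) * c2 * (c2 - (c2 - c1)) *
        ((var_t2 - var_t1) * c2 - var_t2 * (c2 - c1))"
      unfolding gw' by (simp add: algebra_simps power2_eq_square)
    show "\<not> (var_t2 - var_t1 dvd c2 - c1 \<and> var_t2 - var_t1 dvd c2)"
      using nd(1)[OF prime_elem_vars(3)] by (metis dvd_diff_right_iff)
    show "\<not> (var_t2 - var_t1 dvd w - z \<and> var_t2 - var_t1 dvd w)"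
      using nd(2)[OF prime_elem_vars(3)] by (metis dvd_diff_right_iff)
  qed
  have "d \<noteq> 0"
  proof
    assume "d = 0"
    obtain e where e: "w = var_t2 * e" using 2 by blast
    obtain i j where "coeff (coeff e j) i \<noteq> 0"
      using \<open>w \<noteq> 0\<close> e by (metis leading_coeff_neq_0 mult_zero_right)
    then have "coeff (coeff w (Suc j)) i \<noteq> 0" by (simp add: e var_t2_def)
    then show False using hw \<open>d = 0\<close> by (force simp: homogeneous_def)
  qed
  then show ?thesis
    using that[of z w d] hz hw co 1 2 3 by (simp add: z_def w_def)
qed

text \<open>A factor t2 in the second coordinate reproduces itself: \<open>lattes_F\<close> then
  yields t2^2 in the first and t2^3 in the second coordinate, so the quotient by t2^2 is a true
  quotient and has the same shape.\<close>

lemma lattes_seq_step: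
  assumes "lattes_seq C n = (z, var_t2 * e)"
  shows "lattes_seq C (Suc n) = ((var_t1 * var_t2 * e\<^sup>2 - z\<^sup>2)\<^sup>2,
    var_t2 * (4 * z * e * (var_t2 * e - z) * (var_t1 * e - z)))"
proof -
  have t2: "var_t2\<^sup>2 \<noteq> 0" by (simp add: var_t2_def)
  have "fst (lattes_F (z, var_t2 * e)) = var_t2\<^sup>2 * (var_t1 * var_t2 * e\<^sup>2 - z\<^sup>2)\<^sup>2"
    "snd (lattes_F (z, var_t2 * e)) = var_t2\<^sup>2 * (var_t2 * (4 * z * e * (var_t2 * e - z) * (var_t1 * e - z)))"
    by (simp_all add: lattes_F_def algebra_simps power2_eq_square)
  then show ?thesis
    using t2 assms by (simp add: Let_def)
qed

lemma lattes_seq_homogeneous: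
  assumes "homogeneous d (fst (lattes_seq C 0))" "homogeneous d (snd (lattes_seq C 0))"
    "var_t2 dvd snd (lattes_seq C 0)"
  shows "homogeneous (4 ^ n * d) (fst (lattes_seq C n)) \<and> homogeneous (4 ^ n * d) (snd (lattes_seq C n))
    \<and> var_t2 dvd snd (lattes_seq C n)"
proof (induction n)
  case 0
  then show ?case using assms by simp
next
  case (Suc n)
  let ?k = "4 ^ n * d"
  obtain z e where ze: "lattes_seq C n = (z, var_t2 * e)"
    using Suc by (metis dvd_def prod.collapse)
  have t2: "var_t2\<^sup>2 \<noteq> 0" "homogeneous 2 (var_t2\<^sup>2)"
    using homogeneous_power2[OF homogeneous_var_t2] by (simp_all add: var_t2_def)
  have "lattes_F (lattes_seq C n) =
      (var_t2\<^sup>2 * fst (lattes_seq C (Suc n)), var_t2\<^sup>2 * snd (lattes_seq C (Suc n)))"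
    unfolding lattes_seq_step[OF ze] ze
    by (simp add: lattes_F_def algebra_simps power2_eq_square)
  then have "homogeneous (4 * ?k + 2) (var_t2\<^sup>2 * fst (lattes_seq C (Suc n)))"
    "homogeneous (4 * ?k + 2) (var_t2\<^sup>2 * snd (lattes_seq C (Suc n)))"
    using homogeneous_lattes_F Suc by (metis fst_conv snd_conv)+
  then have "homogeneous (4 * ?k + 2 - 2) (fst (lattes_seq C (Suc n)))"
    "homogeneous (4 * ?k + 2 - 2) (snd (lattes_seq C (Suc n)))"
    using homogeneous_cofactor t2 by metis+
  moreover have "4 * ?k + 2 - 2 = 4 ^ Suc n * d" by simp
  moreover have "var_t2 dvd snd (lattes_seq C (Suc n))"
    unfolding lattes_seq_step[OF ze] snd_conv by (rule dvd_triv_left)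
  ultimately show ?case by metis
qed

subsection \<open>Growth of the homogeneous map\<close>

text \<open>This is F_{t,1}. Since F_{t1,t2} is quadratic in (t1, t2), it equals t2^2 times
  \<open>lattes_map (t1 / t2)\<close>.\<close>

definition lattes_map :: "complex \<Rightarrow> complex \<times> complex \<Rightarrow> complex \<times> complex" where
  "lattes_map t X = ((t * (snd X)\<^sup>2 - (fst X)\<^sup>2)\<^sup>2,
     4 * fst X * snd X * (snd X - fst X) * (t * snd X - fst X))"

lemma maxnorm_pos_iff: "0 < maxnorm X \<longleftrightarrow> X \<noteq> (0, 0)"
  by (cases X) (auto simp: maxnorm_def less_max_iff_disj)

lemma maxnorm_nonneg [simp]: "0 \<le> maxnorm X"
  by (simp add: maxnorm_def le_max_iff_disj)

lemma cmod_le_maxnorm: "cmod (fst X) \<le> maxnorm X" "cmod (snd X) \<le> maxnorm X"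
  by (simp_all add: maxnorm_def)

lemma maxnorm_scale: "maxnorm (c * fst X, c * snd X) = cmod c * maxnorm X"
  by (simp add: maxnorm_def norm_mult max_mult_distrib_left)

lemma lattes_map_scale:
  "lattes_map t (c * fst X, c * snd X) = (c ^ 4 * fst (lattes_map t X), c ^ 4 * snd (lattes_map t X))"
proof -
  have "(t * (c * snd X)\<^sup>2 - (c * fst X)\<^sup>2)\<^sup>2 = c ^ 4 * (t * (snd X)\<^sup>2 - (fst X)\<^sup>2)\<^sup>2"
    by algebra
  moreover have "4 * (c * fst X) * (c * snd X) * (c * snd X - c * fst X) * (t * (c * snd X) - c * fst X)
     = c ^ 4 * (4 * fst X * snd X * (snd X - fst X) * (t * snd X - fst X))"
    by algebra
  ultimately show ?thesis by (simp add: lattes_map_def)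
qed

lemma lattes_map_upper:
  assumes "cmod t \<le> R"
  shows "maxnorm (lattes_map t X) \<le> 8 * (R + 1)\<^sup>2 * maxnorm X ^ 4"
proof -
  define M where "M = maxnorm X"
  have M: "cmod (fst X) \<le> M" "cmod (snd X) \<le> M" "0 \<le> M"
    by (simp_all add: M_def cmod_le_maxnorm)
  have R: "0 \<le> R" using assms norm_ge_zero order_trans by blast
  have "cmod (t * (snd X)\<^sup>2 - (fst X)\<^sup>2) \<le> cmod t * cmod (snd X) ^ 2 + cmod (fst X) ^ 2"
    by (metis norm_mult norm_power norm_triangle_ineq4)
  also have "\<dots> \<le> R * M ^ 2 + M ^ 2"
    using M R assms by (intro add_mono mult_mono power_mono) auto
  finally have "cmod (t * (snd X)\<^sup>2 - (fst X)\<^sup>2) \<le> (R + 1) * M\<^sup>2" by (simp add: algebra_simps)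
  then have "cmod (fst (lattes_map t X)) \<le> ((R + 1) * M\<^sup>2)\<^sup>2"
    by (simp add: lattes_map_def norm_power power_mono)
  also have "\<dots> \<le> 8 * (R + 1)\<^sup>2 * M ^ 4"
    by (simp add: power_mult_distrib)
  finally have 1: "cmod (fst (lattes_map t X)) \<le> 8 * (R + 1)\<^sup>2 * M ^ 4" .
  have a: "cmod (snd X - fst X) \<le> 2 * M"
    using M norm_triangle_ineq4[of "snd X" "fst X"] by linarith
  have "cmod (t * snd X - fst X) \<le> cmod t * cmod (snd X) + cmod (fst X)"
    by (metis norm_mult norm_triangle_ineq4)
  also have "\<dots> \<le> R * M + M" using M R assms by (intro add_mono mult_mono) auto
  finally have b: "cmod (t * snd X - fst X) \<le> (R + 1) * M" by (simp add: algebra_simps)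
  have "cmod (snd (lattes_map t X)) =
      4 * cmod (fst X) * cmod (snd X) * cmod (snd X - fst X) * cmod (t * snd X - fst X)"
    by (simp add: lattes_map_def norm_mult)
  also have "\<dots> \<le> 4 * M * M * (2 * M) * ((R + 1) * M)"
    using M R a b by (intro mult_mono) auto
  also have "\<dots> = 8 * (R + 1) * M ^ 4" by algebra
  also have "\<dots> \<le> 8 * (R + 1)\<^sup>2 * M ^ 4"
    using R M self_le_power[of "R + 1" 2] by (intro mult_right_mono) auto
  finally show ?thesis using 1 by (simp add: maxnorm_def M_def[symmetric, unfolded maxnorm_def])
qed

text \<open>A scale-invariant measure of the distance to the degenerate direction \<open>z = 0\<close> of \<open>lattes_map 0\<close>.\<close>
definition depth :: "complex \<Rightarrow> complex \<times> complex \<Rightarrow> real" where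
  "depth t X = max (cmod (fst X) ^ 2) (cmod t * cmod (snd X) ^ 2) / maxnorm X ^ 2"

text \<open>This floor is the purpose of the term |t| |w|^2 in \<open>depth\<close>: even an image
  whose first coordinate vanishes has depth at least |t|.\<close>

lemma depth_ge_param:
  assumes "X \<noteq> (0, 0)" and "cmod t \<le> 1"
  shows "cmod t \<le> depth t X"
proof -
  have "cmod t * maxnorm X ^ 2 \<le> max (cmod (fst X) ^ 2) (cmod t * cmod (snd X) ^ 2)"
  proof (cases "cmod (fst X) \<le> cmod (snd X)")
    case True
    then show ?thesis by (simp add: maxnorm_def max_absorb2 le_max_iff_disj)
  next
    case False
    then have "maxnorm X = cmod (fst X)" by (simp add: maxnorm_def)
    then show ?thesis using assms(2) by (simp add: le_max_iff_disj mult_left_le_one_le)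
  qed
  moreover have "0 < maxnorm X" using assms(1) by (simp add: maxnorm_pos_iff)
  ultimately show ?thesis by (simp add: depth_def pos_le_divide_eq)
qed

lemma depth_le_1:
  assumes "X \<noteq> (0, 0)" and "cmod t \<le> 1"
  shows "depth t X \<le> 1"
proof -
  have "cmod t * cmod (snd X) ^ 2 \<le> 1 * maxnorm X ^ 2"
    using assms by (intro mult_mono power_mono cmod_le_maxnorm) auto
  moreover have "cmod (fst X) ^ 2 \<le> maxnorm X ^ 2"
    by (intro power_mono cmod_le_maxnorm) auto
  moreover have "0 < maxnorm X" using assms(1) by (simp add: maxnorm_pos_iff)
  ultimately show ?thesis by (simp add: depth_def divide_le_eq)
qed

text \<open>Here z^2 dominates t w^2, so the first coordinate of the image is at least |z|^4 / 4,
  and the depth is |z|^2 / M^2 with M the norm. The image norm is at most 16 |z|^2 M^2, so the new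
  depth is at least the square of their quotient; 4096 is 4^2 * 16^2.\<close>

lemma lattes_map_far:
  assumes t: "cmod t \<le> 1 / 16" and X: "X \<noteq> (0, 0)"
    and far: "2 * cmod t * cmod (snd X) ^ 2 \<le> cmod (fst X) ^ 2"
  shows "depth t X ^ 2 / 4 * maxnorm X ^ 4 \<le> maxnorm (lattes_map t X)"
    and "lattes_map t X \<noteq> (0, 0) \<Longrightarrow> depth t X ^ 2 / 4096 \<le> depth t (lattes_map t X)"
proof -
  define a b M where "a = cmod (fst X)" and "b = cmod (snd X)" and "M = maxnorm X"
  have M: "0 < M" "0 \<le> a" "0 \<le> b" "a \<le> M" "b \<le> M"
    using X by (auto simp: a_def b_def M_def maxnorm_pos_iff cmod_le_maxnorm)
  have far': "2 * (cmod t * b\<^sup>2) \<le> a\<^sup>2" using far by (simp add: a_def b_def)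
  have tb: "0 \<le> cmod t * b\<^sup>2" by simp
  then have "max (a\<^sup>2) (cmod t * b\<^sup>2) = a\<^sup>2" using far' by linarith
  then have dX: "depth t X = a\<^sup>2 / M\<^sup>2"
    by (simp add: depth_def a_def[symmetric] b_def[symmetric] M_def[symmetric])
  have d: "depth t X ^ 2 * M ^ 4 = a ^ 4"
    unfolding dX using M by (simp add: power_divide)
  have "a\<^sup>2 - cmod t * b\<^sup>2 \<le> cmod (t * (snd X)\<^sup>2 - (fst X)\<^sup>2)"
    unfolding a_def b_def by (metis norm_minus_commute norm_mult norm_power norm_triangle_ineq2)
  then have "a\<^sup>2 / 2 \<le> cmod (t * (snd X)\<^sup>2 - (fst X)\<^sup>2)" using far' by simp
  then have "(a\<^sup>2 / 2)\<^sup>2 \<le> cmod (fst (lattes_map t X))"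
    by (simp add: lattes_map_def norm_power power_mono)
  then have low: "a ^ 4 / 4 \<le> cmod (fst (lattes_map t X))"
    by (simp add: power_divide)
  then show "depth t X ^ 2 / 4 * maxnorm X ^ 4 \<le> maxnorm (lattes_map t X)"
    using d cmod_le_maxnorm(1)[of "lattes_map t X"] by (simp add: M_def)
  have "cmod (t * (snd X)\<^sup>2 - (fst X)\<^sup>2) \<le> cmod t * b\<^sup>2 + a\<^sup>2"
    unfolding a_def b_def by (metis norm_mult norm_power norm_triangle_ineq4)
  then have "cmod (t * (snd X)\<^sup>2 - (fst X)\<^sup>2) \<le> 2 * a\<^sup>2" using far' tb by linarith
  then have "cmod (t * (snd X)\<^sup>2 - (fst X)\<^sup>2) ^ 2 \<le> (2 * a\<^sup>2)\<^sup>2"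
    by (intro power_mono) auto
  then have "cmod (fst (lattes_map t X)) \<le> (2 * a\<^sup>2)\<^sup>2"
    by (simp only: lattes_map_def norm_power fst_conv)
  also have "\<dots> = 4 * (a\<^sup>2 * a\<^sup>2)" by algebra
  also have "\<dots> \<le> 16 * (a\<^sup>2 * M\<^sup>2)"
    using M by (intro mult_mono power_mono) auto
  finally have up1: "cmod (fst (lattes_map t X)) \<le> 16 * (a\<^sup>2 * M\<^sup>2)" .
  have "(cmod t * b)\<^sup>2 = cmod t * (cmod t * b\<^sup>2)" by algebra
  also have "\<dots> \<le> 1 * (cmod t * b\<^sup>2)" using t by (intro mult_right_mono) auto
  also have "\<dots> \<le> a\<^sup>2" using far' tb by linarith
  finally have tba: "cmod t * b \<le> a" using M by (metis power2_le_imp_le)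
  have "cmod (t * snd X - fst X) \<le> cmod t * b + a"
    unfolding a_def b_def by (metis norm_mult norm_triangle_ineq4)
  then have f2: "cmod (t * snd X - fst X) \<le> 2 * a" using tba by linarith
  have f1: "cmod (snd X - fst X) \<le> 2 * M"
    using M norm_triangle_ineq4[of "snd X" "fst X"] by (simp add: a_def b_def)
  have "cmod (snd (lattes_map t X)) = 4 * a * b * cmod (snd X - fst X) * cmod (t * snd X - fst X)"
    by (simp add: lattes_map_def norm_mult a_def b_def)
  also have "\<dots> \<le> 4 * a * M * (2 * M) * (2 * a)"
    using M f1 f2 by (intro mult_mono) auto
  also have "\<dots> = 16 * (a\<^sup>2 * M\<^sup>2)" by algebra
  finally have up: "maxnorm (lattes_map t X) \<le> 16 * (a\<^sup>2 * M\<^sup>2)"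
    using up1 by (simp add: maxnorm_def)
  assume nz: "lattes_map t X \<noteq> (0, 0)"
  then have pos: "0 < maxnorm (lattes_map t X)" by (simp add: maxnorm_pos_iff)
  then have "0 < a" using up M by (cases "a = 0") auto
  have "depth t X ^ 2 / 4096 = (a ^ 4 / 4)\<^sup>2 / (16 * (a\<^sup>2 * M\<^sup>2))\<^sup>2"
    unfolding dX using M \<open>0 < a\<close> by (simp add: field_simps)
  also have "\<dots> \<le> cmod (fst (lattes_map t X)) ^ 2 / maxnorm (lattes_map t X) ^ 2"
    using low up pos by (intro frac_le power_mono) auto
  also have "\<dots> \<le> depth t (lattes_map t X)"
    unfolding depth_def by (intro divide_right_mono) auto
  finally show "depth t X ^ 2 / 4096 \<le> depth t (lattes_map t X)" .
qed

text \<open>Here depth is at most 2|t| and w carries the norm. If |z|^2 is well below |t| |w|^2, the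
  first coordinate is still bounded below. Otherwise z^2 may equal t w^2, and the second coordinate,
  of size about |z|^2 |w|^2, takes over. The depth of the image is bounded by the floor |t|.\<close>

lemma lattes_map_near:
  assumes t: "cmod t \<le> 1 / 16" and X: "X \<noteq> (0, 0)"
    and near: "cmod (fst X) ^ 2 < 2 * cmod t * cmod (snd X) ^ 2"
  shows "depth t X ^ 2 / 4 * maxnorm X ^ 4 \<le> maxnorm (lattes_map t X)"
    and "lattes_map t X \<noteq> (0, 0) \<Longrightarrow> depth t X ^ 2 / 4096 \<le> depth t (lattes_map t X)"
proof -
  define a b r where "a = cmod (fst X)" and "b = cmod (snd X)" and "r = cmod t"
  have nn: "0 \<le> a" "0 \<le> b" "0 \<le> r" "r \<le> 1 / 16" using t by (auto simp: a_def b_def r_def)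
  have near': "a\<^sup>2 < 2 * (r * b\<^sup>2)" using near by (simp add: a_def b_def r_def)
  have "r * b\<^sup>2 \<le> 1 / 16 * b\<^sup>2" using nn by (intro mult_right_mono) auto
  then have "a\<^sup>2 \<le> b\<^sup>2 / 4" using near' zero_le_power2[of b] by linarith
  then have ab2: "a\<^sup>2 \<le> (b / 2)\<^sup>2" by (simp add: power_divide)
  then have ab: "a \<le> b / 2" using nn by (metis divide_nonneg_nonneg power2_le_imp_le zero_le_numeral)
  then have M: "maxnorm X = b" using nn by (simp add: maxnorm_def a_def[symmetric] b_def[symmetric])
  have "0 < b" using X M by (metis maxnorm_pos_iff)
  have d: "depth t X = max (a\<^sup>2) (r * b\<^sup>2) / b\<^sup>2"
    by (simp add: depth_def M a_def b_def r_def)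
  then have dr: "depth t X \<le> 2 * r"
    using near' nn \<open>0 < b\<close> by (simp add: divide_le_eq)
  have d0: "0 \<le> depth t X" by (simp add: depth_def le_max_iff_disj)
  show "depth t X ^ 2 / 4 * maxnorm X ^ 4 \<le> maxnorm (lattes_map t X)"
  proof (cases "2 * a\<^sup>2 \<le> r * b\<^sup>2")
    case True
    then have "max (a\<^sup>2) (r * b\<^sup>2) = r * b\<^sup>2" using zero_le_power2[of a] by linarith
    then have "depth t X = r" using d \<open>0 < b\<close> by simp
    have "r * b\<^sup>2 - a\<^sup>2 \<le> cmod (t * (snd X)\<^sup>2 - (fst X)\<^sup>2)"
      unfolding a_def b_def r_def by (metis norm_mult norm_power norm_triangle_ineq2)
    then have "r * b\<^sup>2 / 2 \<le> cmod (t * (snd X)\<^sup>2 - (fst X)\<^sup>2)" using True by simp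
    then have "(r * b\<^sup>2 / 2)\<^sup>2 \<le> cmod (fst (lattes_map t X))"
      using nn by (simp add: lattes_map_def norm_power power_mono)
    also have "\<dots> \<le> maxnorm (lattes_map t X)" by (rule cmod_le_maxnorm)
    also have "(r * b\<^sup>2 / 2)\<^sup>2 = depth t X ^ 2 / 4 * maxnorm X ^ 4"
      by (simp add: \<open>depth t X = r\<close> M power_mult_distrib power_divide)
    finally show ?thesis .
  next
    case False
    \<comment> \<open>Smallness of t gives |t w| \<le> |z| / 2, which keeps the factor t w - z
      comparable to z.\<close>
    have "(2 * (r * b))\<^sup>2 = r * (4 * (r * b\<^sup>2))" by algebra
    also have "\<dots> \<le> 1 / 16 * (4 * (r * b\<^sup>2))" using nn by (intro mult_right_mono) auto
    also have "\<dots> \<le> a\<^sup>2" using False zero_le_power2[of a] by linarith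
    finally have "2 * (r * b) \<le> a" using nn by (metis power2_le_imp_le)
    moreover have "a - r * b \<le> cmod (t * snd X - fst X)"
      unfolding a_def b_def r_def by (metis norm_minus_commute norm_mult norm_triangle_ineq2)
    ultimately have f2: "a / 2 \<le> cmod (t * snd X - fst X)" by simp
    have "b - a \<le> cmod (snd X - fst X)"
      unfolding a_def b_def by (rule norm_triangle_ineq2)
    then have f1: "b / 2 \<le> cmod (snd X - fst X)" using ab by simp
    have "depth t X ^ 2 / 4 * maxnorm X ^ 4 \<le> (2 * r) ^ 2 / 4 * b ^ 4"
      unfolding M using dr d0 by (intro mult_right_mono divide_right_mono power_mono) auto
    also have "\<dots> = r * (r * b\<^sup>2) * b\<^sup>2" by algebra
    also have "\<dots> \<le> 1 / 16 * (r * b\<^sup>2) * b\<^sup>2" using nn by (intro mult_right_mono) auto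
    also have "1 / 16 * (r * b\<^sup>2) \<le> a\<^sup>2" using False zero_le_power2[of a] by linarith
    then have "1 / 16 * (r * b\<^sup>2) * b\<^sup>2 \<le> a\<^sup>2 * b\<^sup>2" by (rule mult_right_mono) simp
    also have "\<dots> = 4 * a * b * (b / 2) * (a / 2)" by (simp add: power2_eq_square)
    also have "\<dots> \<le> 4 * a * b * cmod (snd X - fst X) * cmod (t * snd X - fst X)"
      using nn f1 f2 by (intro mult_mono) auto
    also have "\<dots> = cmod (snd (lattes_map t X))"
      by (simp add: lattes_map_def norm_mult a_def b_def)
    also have "\<dots> \<le> maxnorm (lattes_map t X)" by (rule cmod_le_maxnorm)
    finally show ?thesis .
  qed
  assume nz: "lattes_map t X \<noteq> (0, 0)"
  have "depth t X ^ 2 \<le> depth t X"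
    using depth_le_1[OF X] t d0 by (simp add: power2_eq_square mult_left_le)
  then have "depth t X ^ 2 / 4096 \<le> r" using dr nn by simp
  also have "\<dots> \<le> depth t (lattes_map t X)"
    unfolding r_def using nz t by (intro depth_ge_param) auto
  finally show "depth t X ^ 2 / 4096 \<le> depth t (lattes_map t X)" .
qed

lemma lattes_map_depth:
  assumes "cmod t \<le> 1 / 16" and "X \<noteq> (0, 0)"
  shows "depth t X ^ 2 / 4 * maxnorm X ^ 4 \<le> maxnorm (lattes_map t X)"
    and "lattes_map t X \<noteq> (0, 0) \<Longrightarrow> depth t X ^ 2 / 4096 \<le> depth t (lattes_map t X)"
  using lattes_map_far[OF assms] lattes_map_near[OF assms] by (meson linorder_not_less)+

text \<open>Needed over t = infinity: the right-hand side is the norm after the second coordinate is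
  multiplied by t, that is, after passing from \<open>orb_inf\<close> back to
  \<open>orb\<close>.\<close>

lemma depth_le_weighted_norm:
  assumes "X \<noteq> (0, 0)" and "cmod t \<le> 1"
  shows "depth t X * maxnorm X \<le> max (cmod (fst X)) (cmod t * cmod (snd X))"
proof -
  define M where "M = maxnorm X"
  have M: "0 < M" "cmod (fst X) \<le> M" "cmod (snd X) \<le> M"
    using assms by (auto simp: M_def maxnorm_pos_iff cmod_le_maxnorm)
  have "cmod (fst X) ^ 2 \<le> cmod (fst X) * M"
    using M by (simp add: power2_eq_square mult_left_mono)
  moreover have "cmod t * cmod (snd X) ^ 2 \<le> cmod t * cmod (snd X) * M"
    unfolding power2_eq_square mult.assoc using M by (intro mult_left_mono) auto
  ultimately have "max (cmod (fst X) ^ 2) (cmod t * cmod (snd X) ^ 2) \<le>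
      max (cmod (fst X) * M) (cmod t * cmod (snd X) * M)"
    by (rule max.mono)
  also have "\<dots> = max (cmod (fst X)) (cmod t * cmod (snd X)) * M"
    using M by (simp add: max_mult_distrib_right)
  finally have "max (cmod (fst X) ^ 2) (cmod t * cmod (snd X) ^ 2) / M \<le>
      max (cmod (fst X)) (cmod t * cmod (snd X))"
    using M by (simp add: divide_le_eq)
  then show ?thesis
    using M by (simp add: depth_def M_def[symmetric] power2_eq_square)
qed

text \<open>The loss is allowed to grow like \<open>2 ^ n\<close>: the orbit may be attracted to the superattracting
  fixed point \<open>0\<close> of \<open>lattes_map 0\<close>, but only at a quadratic rate.\<close>
lemma degenerate_orbit_bound:
  fixes Y :: "nat \<Rightarrow> complex \<times> complex"
  assumes t: "cmod t \<le> 1 / 16" and step: "\<And>n. Y (Suc n) = lattes_map t (Y n)"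
    and \<rho>: "0 < \<rho>" "\<rho> \<le> 1" and Y0: "Y 0 \<noteq> (0, 0)" "\<rho> * maxnorm (Y 0) \<le> cmod (fst (Y 0))"
  defines "K \<equiv> 2 * ln (4096 / \<rho>\<^sup>2) + ln 32"
  shows "Y n \<noteq> (0, 0)"
    and "\<bar>ln (maxnorm (Y (Suc n))) - 4 * ln (maxnorm (Y n))\<bar> \<le> K * 2 ^ n"
    and "0 < max (cmod (fst (Y n))) (cmod t * cmod (snd (Y n)))"
    and "ln (maxnorm (Y n)) - K * 2 ^ n \<le> ln (max (cmod (fst (Y n))) (cmod t * cmod (snd (Y n))))"
proof -
  \<comment> \<open>Division by 4096 turns the recursion d' \<ge> d^2 / 4096 into pure squaring; the
    cone condition gives initial depth at least \<rho> squared, which is 4096 \<kappa>.\<close>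
  define \<kappa> where "\<kappa> = \<rho>\<^sup>2 / 4096"
  have \<kappa>: "0 < \<kappa>" using \<rho> by (simp add: \<kappa>_def)
  have inv: "Y n \<noteq> (0, 0) \<and> 4096 * \<kappa> ^ (2 ^ n) \<le> depth t (Y n)" for n
  proof (induction n)
    case 0
    have "\<rho>\<^sup>2 * maxnorm (Y 0) ^ 2 \<le> cmod (fst (Y 0)) ^ 2"
      using power_mono[OF Y0(2), of 2] \<rho> by (simp add: power_mult_distrib)
    moreover have "0 < maxnorm (Y 0)" using Y0(1) by (simp add: maxnorm_pos_iff)
    ultimately have "\<rho>\<^sup>2 \<le> depth t (Y 0)"
      by (simp add: depth_def pos_le_divide_eq le_max_iff_disj)
    then show ?case using Y0(1) by (simp add: \<kappa>_def)
  next
    case (Suc n)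
    then have Yn: "Y n \<noteq> (0, 0)" and d: "4096 * \<kappa> ^ (2 ^ n) \<le> depth t (Y n)" by auto
    have dpos: "0 < depth t (Y n)"
      by (rule less_le_trans[OF _ d]) (use \<kappa> in simp)
    have "0 < depth t (Y n) ^ 2 / 4 * maxnorm (Y n) ^ 4"
      using dpos Yn[folded maxnorm_pos_iff] by simp
    then have "0 < maxnorm (lattes_map t (Y n))"
      using lattes_map_depth(1)[OF t Yn] by linarith
    then have nz: "lattes_map t (Y n) \<noteq> (0, 0)" by (simp add: maxnorm_pos_iff)
    have "4096 * \<kappa> ^ (2 ^ Suc n) = (4096 * \<kappa> ^ (2 ^ n))\<^sup>2 / 4096"
      by (simp add: power_mult_distrib power_mult[symmetric] mult.commute)
    also have "\<dots> \<le> depth t (Y n) ^ 2 / 4096"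
      using d \<kappa> by (intro divide_right_mono power_mono) auto
    also have "\<dots> \<le> depth t (Y (Suc n))"
      unfolding step by (rule lattes_map_depth(2)[OF t Yn nz])
    finally show ?case using nz step by simp
  qed
  then show Yn: "Y n \<noteq> (0, 0)" by blast
  define M where "M = maxnorm (Y n)"
  have M: "0 < M" using Yn by (simp add: M_def maxnorm_pos_iff)
  define D where "D = depth t (Y n)"
  have "\<kappa> ^ (2 ^ n) \<le> 4096 * \<kappa> ^ (2 ^ n)" using \<kappa> by simp
  then have D: "\<kappa> ^ (2 ^ n) \<le> D" using inv[of n] by (simp add: D_def)
  have Dpos: "0 < D" by (rule less_le_trans[OF _ D]) (use \<kappa> in simp)
  have "ln (\<kappa> ^ (2 ^ n)) \<le> ln D" using D \<kappa> Dpos by simp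
  then have lnD: "- ln D \<le> 2 ^ n * ln (4096 / \<rho>\<^sup>2)"
    using \<kappa> \<rho> by (simp add: ln_realpow \<kappa>_def ln_div algebra_simps)
  have \<rho>2: "\<rho>\<^sup>2 \<le> 1" using \<rho> by (simp add: power_le_one)
  have pos: "0 \<le> ln (4096 / \<rho>\<^sup>2)" "0 \<le> ln (32::real)" using \<rho> \<rho>2 by (auto simp: field_simps)
  \<comment> \<open>The term \<open>ln 32\<close> covers both the \<open>ln 4\<close> of the lower
    bound and the constant 8 (1 + 1)^2 of \<open>lattes_map_upper\<close> with R = 1; the remaining
    part of \<open>K\<close> pays for twice the logarithm of the depth.\<close>
  have K: "2 * (2 ^ n * ln (4096 / \<rho>\<^sup>2)) + ln 32 \<le> K * 2 ^ n"
    using pos by (simp add: K_def algebra_simps)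
  have MS: "0 < maxnorm (Y (Suc n))" using inv[of "Suc n"] by (simp add: maxnorm_pos_iff)
  have "D\<^sup>2 / 4 * M ^ 4 \<le> maxnorm (Y (Suc n))"
    unfolding D_def M_def step by (rule lattes_map_depth(1)[OF t Yn])
  then have "ln (D\<^sup>2 / 4 * M ^ 4) \<le> ln (maxnorm (Y (Suc n)))"
    using Dpos M MS by (intro ln_mono) auto
  then have "2 * ln D - ln 4 + 4 * ln M \<le> ln (maxnorm (Y (Suc n)))"
    using Dpos M by (simp add: ln_mult ln_div ln_realpow)
  moreover have "ln (4::real) \<le> ln 32" by simp
  ultimately have low: "- (K * 2 ^ n) \<le> ln (maxnorm (Y (Suc n))) - 4 * ln M"
    using lnD K by linarith
  have "maxnorm (Y (Suc n)) \<le> 32 * M ^ 4"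
    using lattes_map_upper[of t 1 "Y n"] t by (simp add: step M_def)
  then have "ln (maxnorm (Y (Suc n))) \<le> ln (32 * M ^ 4)"
    using M MS by (intro ln_mono) auto
  also have "\<dots> = ln 32 + 4 * ln M" using M by (simp add: ln_mult ln_realpow)
  finally show "\<bar>ln (maxnorm (Y (Suc n))) - 4 * ln (maxnorm (Y n))\<bar> \<le> K * 2 ^ n"
    using low K pos(1) unfolding M_def[symmetric]
    by (smt (verit) mult_nonneg_nonneg zero_le_power)
  have DM: "D * M \<le> max (cmod (fst (Y n))) (cmod t * cmod (snd (Y n)))"
    unfolding D_def M_def using t by (intro depth_le_weighted_norm Yn) auto
  show pos_max: "0 < max (cmod (fst (Y n))) (cmod t * cmod (snd (Y n)))"
    using DM mult_pos_pos[OF Dpos M] by linarith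
  have "ln (D * M) \<le> ln (max (cmod (fst (Y n))) (cmod t * cmod (snd (Y n))))"
    using DM Dpos M pos_max by (intro ln_mono) auto
  moreover have "ln (D * M) = ln D + ln M" using Dpos M by (simp add: ln_mult)
  moreover have "- ln D \<le> K * 2 ^ n"
    using lnD K pos by (smt (verit) mult_nonneg_nonneg zero_le_power)
  ultimately show "ln (maxnorm (Y n)) - K * 2 ^ n \<le> ln (max (cmod (fst (Y n))) (cmod t * cmod (snd (Y n))))"
    unfolding M_def by linarith
qed

section \<open>Parameters away from 0, 1 and infinity\<close>

lemma lattes_map_eq_0_iff:
  assumes "t \<noteq> 0" and "t \<noteq> 1"
  shows "lattes_map t X = (0, 0) \<longleftrightarrow> X = (0, 0)"
proof
  assume "lattes_map t X = (0, 0)"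
  then have "t * (snd X)\<^sup>2 = (fst X)\<^sup>2"
    and "fst X = 0 \<or> snd X = 0 \<or> snd X = fst X \<or> t * snd X = fst X"
    by (auto simp: lattes_map_def)
  then show "X = (0, 0)"
    using assms by (cases X) (auto simp: power2_eq_square)
qed (simp add: lattes_map_def)

text \<open>On a compact ball of parameters times the unit sphere of \<open>maxnorm\<close> the
  image norm has a positive minimum; homogeneity of degree 4 carries the bound to all
  vectors.\<close>

lemma nondegenerate_bound:
  assumes t0: "t0 \<noteq> 0" "t0 \<noteq> 1"
  shows "\<exists>K. \<forall>\<^sub>F t in nhds t0. \<forall>X. X \<noteq> (0, 0) \<longrightarrow>
    lattes_map t X \<noteq> (0, 0) \<and> \<bar>ln (maxnorm (lattes_map t X)) - 4 * ln (maxnorm X)\<bar> \<le> K"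
proof -
  obtain r where r: "0 < r" "cball t0 r \<subseteq> - {0, 1}"
    using open_contains_cball[of "- {0, 1 :: complex}"] t0 by auto
  define S where "S = cball t0 r \<times> {X. maxnorm X = 1}"
  have cont_maxnorm: "continuous_on UNIV maxnorm"
    unfolding maxnorm_def by (intro continuous_intros)
  have "compact {X. maxnorm X = 1}"
  proof (rule compact_eq_bounded_closed[THEN iffD2], rule conjI)
    have "{X. maxnorm X = 1} \<subseteq> cball 0 1 \<times> cball 0 1"
      by (auto simp: maxnorm_def)
    then show "bounded {X. maxnorm X = 1}"
      by (rule bounded_subset[OF bounded_Times[OF bounded_cball bounded_cball]])
    show "closed {X. maxnorm X = 1}"
      by (intro closed_Collect_eq cont_maxnorm continuous_intros)
  qed
  then have "compact S" unfolding S_def by (intro compact_Times compact_cball)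
  moreover have "(t0, (1, 0)) \<in> S" using r by (simp add: S_def maxnorm_def)
  moreover have "continuous_on S (\<lambda>y. maxnorm (lattes_map (fst y) (snd y)))"
    unfolding lattes_map_def maxnorm_def by (intro continuous_intros)
  ultimately obtain y where y: "y \<in> S"
    "\<And>s. s \<in> S \<Longrightarrow> maxnorm (lattes_map (fst y) (snd y)) \<le> maxnorm (lattes_map (fst s) (snd s))"
    using continuous_attains_inf[of S] by blast
  define m where "m = maxnorm (lattes_map (fst y) (snd y))"
  have "fst y \<noteq> 0" "fst y \<noteq> 1" "snd y \<noteq> (0, 0)"
    using y(1) r(2) by (auto simp: S_def maxnorm_def)
  then have m: "0 < m" by (simp add: m_def maxnorm_pos_iff lattes_map_eq_0_iff)
  define K where "K = \<bar>ln m\<bar> + \<bar>ln (8 * (cmod t0 + r + 1)\<^sup>2)\<bar>"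
  have "lattes_map t X \<noteq> (0, 0) \<and> \<bar>ln (maxnorm (lattes_map t X)) - 4 * ln (maxnorm X)\<bar> \<le> K"
    if t: "t \<in> cball t0 r" and X: "X \<noteq> (0, 0)" for t X
  proof
    have "t \<noteq> 0" "t \<noteq> 1" using subsetD[OF r(2) t] by auto
    then show nz: "lattes_map t X \<noteq> (0, 0)" using X by (simp add: lattes_map_eq_0_iff)
    define M where "M = maxnorm X"
    have M: "0 < M" using X by (simp add: M_def maxnorm_pos_iff)
    have L: "0 < maxnorm (lattes_map t X)" using nz by (simp add: maxnorm_pos_iff)
    define c :: complex where "c = of_real (1 / M)"
    have "maxnorm (c * fst X, c * snd X) = 1"
      unfolding maxnorm_scale M_def[symmetric] using M by (simp add: c_def norm_divide)
    then have "(t, (c * fst X, c * snd X)) \<in> S" using t by (simp add: S_def)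
    then have "m \<le> maxnorm (lattes_map t (c * fst X, c * snd X))"
      using y(2) unfolding m_def by fastforce
    also have "\<dots> = maxnorm (lattes_map t X) / M ^ 4"
      unfolding lattes_map_scale maxnorm_scale norm_power using M by (simp add: c_def norm_divide power_divide)
    finally have "m * M ^ 4 \<le> maxnorm (lattes_map t X)" using M by (simp add: field_simps)
    then have "ln (m * M ^ 4) \<le> ln (maxnorm (lattes_map t X))"
      using m M L by (intro ln_mono) auto
    then have low: "ln m + 4 * ln M \<le> ln (maxnorm (lattes_map t X))"
      using m M by (simp add: ln_mult ln_realpow)
    have "cmod t \<le> cmod t0 + r"
      using t norm_triangle_ineq2[of t t0] by (simp add: dist_norm norm_minus_commute)
    then have "maxnorm (lattes_map t X) \<le> 8 * (cmod t0 + r + 1)\<^sup>2 * M ^ 4"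
      unfolding M_def by (rule lattes_map_upper)
    then have "ln (maxnorm (lattes_map t X)) \<le> ln (8 * (cmod t0 + r + 1)\<^sup>2 * M ^ 4)"
      using L by (intro ln_mono) auto
    also have "\<dots> = ln (8 * (cmod t0 + r + 1)\<^sup>2) + 4 * ln M"
    proof -
      have "0 < cmod t0 + r + 1" using r(1) by (smt (verit) norm_ge_zero)
      then have "0 < 8 * (cmod t0 + r + 1)\<^sup>2" by simp
      then show ?thesis using M by (subst ln_mult) (simp_all add: ln_realpow)
    qed
    finally show "\<bar>ln (maxnorm (lattes_map t X)) - 4 * ln (maxnorm X)\<bar> \<le> K"
      using low unfolding K_def M_def by linarith
  qed
  moreover have "\<forall>\<^sub>F t in nhds t0. t \<in> cball t0 r"
    using r(1) by (metis ball_subset_cball centre_in_ball eventually_nhds open_ball subsetD)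
  ultimately show ?thesis by (intro exI[of _ K]) (auto elim!: eventually_mono)
qed

subsection \<open>Sub-mean inequality\<close>

text \<open>On the unit circle \<open>cnj z = 1 / z\<close>, so real polynomial functions become Laurent polynomials.\<close>
lemma real_polynomial_function_on_circle:
  assumes "real_polynomial_function f"
  shows "\<exists>N H. \<forall>z\<in>sphere 0 1. complex_of_real (f z) * z ^ N = poly H z"
  using assms
proof induction
  case (linear f)
  define H where "H = [:(of_real (f 1) + \<i> * of_real (f \<i>)) / 2, 0, (of_real (f 1) - \<i> * of_real (f \<i>)) / 2:]"
  have "complex_of_real (f z) * z ^ 1 = poly H z" if "z \<in> sphere 0 1" for z
  proof -
    have "z * cnj z = 1" using that by (simp add: complex_norm_square[symmetric])
    then have "(z + cnj z) * z = z ^ 2 + 1" "(z - cnj z) * z = z ^ 2 - 1"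
      by (simp_all add: algebra_simps power2_eq_square)
    moreover have "z + cnj z = 2 * of_real (Re z)" "z - cnj z = 2 * \<i> * of_real (Im z)"
      by (simp_all add: complex_eq_iff)
    ultimately have "2 * of_real (Re z) * z = z ^ 2 + 1" "2 * \<i> * of_real (Im z) * z = z ^ 2 - 1"
      by simp_all
    moreover have "of_real (Im z) * z = - \<i> * (2 * \<i> * of_real (Im z) * z) / 2"
      by (simp add: field_simps)
    ultimately have z: "of_real (Re z) * z = (z ^ 2 + 1) / 2" "of_real (Im z) * z = - \<i> * (z ^ 2 - 1) / 2"
      by (simp_all only:) (simp add: field_simps)
    have "f z = f (Re z *\<^sub>R 1 + Im z *\<^sub>R \<i>)"
      by (rule arg_cong[where f = f]) (simp add: complex_eq_iff)
    also have "\<dots> = Re z * f 1 + Im z * f \<i>"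
      using linear by (simp add: bounded_linear.linear linear_add linear_scale)
    finally have "complex_of_real (f z) * z = of_real (f 1) * (of_real (Re z) * z) + of_real (f \<i>) * (of_real (Im z) * z)"
      by (simp add: algebra_simps)
    then show ?thesis
      unfolding z by (simp add: H_def field_simps power2_eq_square)
  qed
  then show ?case by blast
next
  case (const c)
  have "\<forall>z\<in>sphere 0 1. complex_of_real c * z ^ 0 = poly [:of_real c:] z" by simp
  then show ?case by blast
next
  case (add f g)
  then obtain M N F G where "\<forall>z\<in>sphere 0 1. complex_of_real (f z) * z ^ M = poly F z"
    "\<forall>z\<in>sphere 0 1. complex_of_real (g z) * z ^ N = poly G z" by blast
  then have "\<forall>z\<in>sphere 0 1. complex_of_real (f z + g z) * z ^ (M + N) = poly (F * monom 1 N + G * monom 1 M) z"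
    by (auto simp: poly_monom algebra_simps power_add)
  then show ?case by blast
next
  case (mult f g)
  then obtain M N F G where "\<forall>z\<in>sphere 0 1. complex_of_real (f z) * z ^ M = poly F z"
    "\<forall>z\<in>sphere 0 1. complex_of_real (g z) * z ^ N = poly G z" by blast
  moreover have "complex_of_real (f z * g z) * z ^ (M + N) =
      (complex_of_real (f z) * z ^ M) * (complex_of_real (g z) * z ^ N)" for z
    by (simp add: power_add)
  ultimately have "\<forall>z\<in>sphere 0 1. complex_of_real (f z * g z) * z ^ (M + N) = poly (F * G) z"
    by (intro ballI) (simp only: poly_mult)
  then show ?case by blast
qed

text \<open>On the circle a / z^k is the conjugate of cnj a * z^k, so a negative power can be
  reflected to a positive one without changing the real part. Thus real polynomial functions on the
  circle become real parts of polynomials.\<close>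

lemma Re_Laurent_on_circle:
  "\<exists>h. \<forall>z\<in>sphere 0 1. Re (poly H z / z ^ N) = Re (poly h z)"
proof (induction N arbitrary: H)
  case 0
  then show ?case by auto
next
  case (Suc N)
  obtain a H' where H: "H = pCons a H'" by (cases H)
  obtain h where h: "\<forall>z\<in>sphere 0 1. Re (poly H' z / z ^ N) = Re (poly h z)"
    using Suc.IH by blast
  have "Re (poly H z / z ^ Suc N) = Re (poly (monom (cnj a) (Suc N) + h) z)" if z: "z \<in> sphere 0 1" for z
  proof -
    have "z \<noteq> 0" using z by auto
    have "cnj z = inverse z"
      using z by (intro inverse_unique[symmetric]) (simp add: complex_norm_square[symmetric])
    then have "cnj (cnj a * z ^ Suc N) = a / z ^ Suc N"
      by (simp add: divide_inverse power_inverse)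
    then have "Re (a / z ^ Suc N) = Re (cnj a * z ^ Suc N)" by (metis cnj.sel(1))
    moreover have "poly H z / z ^ Suc N = a / z ^ Suc N + poly H' z / z ^ N"
      using \<open>z \<noteq> 0\<close> by (simp add: H add_divide_distrib)
    ultimately show ?thesis using h z by (simp add: poly_monom)
  qed
  then show ?case by blast
qed

text \<open>The exponent is left general because splitting off the lowest coefficient of
  \<open>h\<close> raises it by one.\<close>

lemma has_integral_cis_power_poly:
  "((\<lambda>\<theta>. cis \<theta> ^ Suc k * poly h (cis \<theta>)) has_integral 0) {0..2 * pi}"
proof (induction h arbitrary: k)
  case (pCons a h)
  let ?F = "\<lambda>\<theta>. cis (real (Suc k) * \<theta>) / (\<i> * of_nat (Suc k))"
  have "((\<lambda>\<theta>. cis (real (Suc k) * \<theta>)) has_integral ?F (2 * pi) - ?F 0) {0..2 * pi}"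
  proof (rule fundamental_theorem_of_calculus)
    fix \<theta> assume "\<theta> \<in> {0..2 * pi}"
    define c where "c = \<i> * of_nat (Suc k)"
    have "c \<noteq> 0" unfolding c_def using of_nat_neq_0[where 'a = complex] by simp
    then have "((\<lambda>z. exp (c * z) / c) has_field_derivative exp (c * of_real \<theta>)) (at (of_real \<theta>))"
      by (auto intro!: derivative_eq_intros)
    then have "((\<lambda>x. exp (c * of_real x) / c) has_vector_derivative exp (c * of_real \<theta>)) (at \<theta> within {0..2 * pi})"
      by (rule has_vector_derivative_real_field)
    then show "(?F has_vector_derivative cis (real (Suc k) * \<theta>)) (at \<theta> within {0..2 * pi})"
      by (simp add: cis_conv_exp c_def mult.assoc del: of_nat_Suc)
  qed simp
  moreover have "cis (real (Suc k) * (2 * pi)) = 1"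
    by (simp add: cis_multiple_2pi mult.commute[of _ "2 * pi"] del: of_nat_Suc)
  ultimately have "((\<lambda>\<theta>. cis (real (Suc k) * \<theta>)) has_integral 0) {0..2 * pi}"
    by (simp del: of_nat_Suc)
  moreover have "cis \<theta> ^ Suc k = cis (real (Suc k) * \<theta>)" for \<theta>
    by (rule Complex.DeMoivre)
  ultimately have "((\<lambda>\<theta>. cis \<theta> ^ Suc k) has_integral 0) {0..2 * pi}"
    by (simp only:)
  then have "((\<lambda>\<theta>. a * cis \<theta> ^ Suc k + cis \<theta> ^ Suc (Suc k) * poly h (cis \<theta>)) has_integral a * 0 + 0) {0..2 * pi}"
    by (intro has_integral_add has_integral_mult_right pCons.IH)
  then show ?case by (simp add: algebra_simps)
qed simp

lemma has_integral_Re_poly_circle: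
  "((\<lambda>\<theta>. Re (poly h (cis \<theta>))) has_integral 2 * pi * Re (poly h 0)) {0..2 * pi}"
proof -
  obtain a h' where h: "h = pCons a h'" by (cases h)
  have "((\<lambda>\<theta>. a + cis \<theta> ^ Suc 0 * poly h' (cis \<theta>)) has_integral (2 * pi - 0) *\<^sub>R a + 0) {0..2 * pi}"
    using has_integral_const_real[of a 0 "2 * pi"]
    by (intro has_integral_add has_integral_cis_power_poly) simp
  then have "((\<lambda>\<theta>. poly h (cis \<theta>)) has_integral (2 * pi) *\<^sub>R poly h 0) {0..2 * pi}"
    by (simp add: h)
  then have "((Re \<circ> (\<lambda>\<theta>. poly h (cis \<theta>))) has_integral Re ((2 * pi) *\<^sub>R poly h 0)) {0..2 * pi}"
    by (intro has_integral_linear bounded_linear_Re)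
  then show ?thesis by (simp add: o_def)
qed

text \<open>Multiplying by \<open>exp (- h)\<close> with \<open>Re h\<close> close to \<open>g\<close> on the circle reduces the sub-mean
  inequality for \<open>ln \<bar>f\<bar>\<close> to the maximum principle, with no regard to the zeros of \<open>f\<close>.\<close>
lemma ln_cmod_le_circle_mean:
  fixes f :: "complex \<Rightarrow> complex" and g :: "complex \<Rightarrow> real"
  assumes f: "f holomorphic_on UNIV" and g: "continuous_on (sphere 0 1) g"
    and le: "\<And>z. z \<in> sphere 0 1 \<Longrightarrow> cmod (f z) \<le> exp (g z)" and nz: "f 0 \<noteq> 0"
  shows "ln (cmod (f 0)) \<le> 1 / (2 * pi) * integral {0..2 * pi} (\<lambda>\<theta>. g (cis \<theta>))"
proof (rule field_le_epsilon)
  fix e :: real assume "0 < e"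
  \<comment> \<open>One half of e is spent in the maximum principle, the other when the integral of
    the approximating polynomial is compared with that of g.\<close>
  then have "0 < e / 2" by simp
  then obtain p where p: "real_polynomial_function p" "\<And>z. z \<in> sphere 0 1 \<Longrightarrow> \<bar>g z - p z\<bar> < e / 2"
    using Stone_Weierstrass_real_polynomial_function[OF compact_sphere g] by blast
  obtain N H where NH: "\<forall>z\<in>sphere 0 1. complex_of_real (p z) * z ^ N = poly H z"
    using real_polynomial_function_on_circle[OF p(1)] by blast
  obtain h where h: "\<forall>z\<in>sphere 0 1. Re (poly H z / z ^ N) = Re (poly h z)"
    using Re_Laurent_on_circle by blast
  have ph: "p z = Re (poly h z)" if z: "z \<in> sphere 0 1" for z
  proof -
    have "z \<noteq> 0" using z by auto
    then have "poly H z / z ^ N = complex_of_real (p z)" using NH z by (simp add: field_simps)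
    then show ?thesis using h z by (metis Re_complex_of_real)
  qed
  have "cmod (f 0 * exp (- poly h 0)) \<le> exp (e / 2)"
  proof (rule maximum_modulus_frontier[of "\<lambda>z. f z * exp (- poly h z)" "cball 0 1"])
    show "(\<lambda>z. f z * exp (- poly h z)) holomorphic_on interior (cball 0 1)"
      by (intro holomorphic_intros holomorphic_on_subset[OF f]) auto
    have "(\<lambda>z. f z * exp (- poly h z)) holomorphic_on UNIV"
      by (intro holomorphic_intros f)
    then show "continuous_on (closure (cball 0 1)) (\<lambda>z. f z * exp (- poly h z))"
      by (meson holomorphic_on_imp_continuous_on continuous_on_subset subset_UNIV)
    fix z :: complex assume "z \<in> frontier (cball 0 1)"
    then have z: "z \<in> sphere 0 1" by simp
    have "cmod (f z * exp (- poly h z)) \<le> exp (g z) * exp (- p z)"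
      unfolding norm_mult norm_exp_eq_Re using le[OF z] ph[OF z] by (intro mult_mono) auto
    also have "\<dots> = exp (g z - p z)" by (simp add: mult_exp_exp)
    also have "\<dots> \<le> exp (e / 2)" unfolding exp_le_cancel_iff using p(2)[OF z] by linarith
    finally show "cmod (f z * exp (- poly h z)) \<le> exp (e / 2)" .
  qed auto
  then have "cmod (f 0) \<le> exp (e / 2) * exp (Re (poly h 0))"
    by (simp add: norm_mult norm_divide exp_minus field_simps)
  then have "cmod (f 0) \<le> exp (e / 2 + Re (poly h 0))" by (simp add: exp_add)
  then have 1: "ln (cmod (f 0)) \<le> e / 2 + Re (poly h 0)"
    using nz by (metis exp_le_cancel_iff exp_ln zero_less_norm_iff)
  have "continuous_on {0..2 * pi} (\<lambda>\<theta>. g (cis \<theta>))"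
    by (rule continuous_on_compose2[OF g]) (auto intro!: continuous_intros)
  then have gi: "(\<lambda>\<theta>. g (cis \<theta>)) integrable_on {0..2 * pi}"
    by (rule integrable_continuous_interval)
  have "2 * pi * Re (poly h 0) = integral {0..2 * pi} (\<lambda>\<theta>. Re (poly h (cis \<theta>)))"
    using has_integral_Re_poly_circle by (metis integral_unique)
  also have "\<dots> \<le> integral {0..2 * pi} (\<lambda>\<theta>. g (cis \<theta>) + e / 2)"
  proof (rule integral_le)
    show "(\<lambda>\<theta>. g (cis \<theta>) + e / 2) integrable_on {0..2 * pi}"
      by (intro integrable_add gi integrable_const_ivl)
    show "(\<lambda>\<theta>. Re (poly h (cis \<theta>))) integrable_on {0..2 * pi}"
      using has_integral_Re_poly_circle by blast
    show "Re (poly h (cis \<theta>)) \<le> g (cis \<theta>) + e / 2" for \<theta>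
      using p(2)[of "cis \<theta>"] ph[of "cis \<theta>"] unfolding mem_sphere_0 norm_cis by linarith
  qed
  also have "\<dots> = integral {0..2 * pi} (\<lambda>\<theta>. g (cis \<theta>)) + 2 * pi * (e / 2)"
    by (subst integral_add[OF gi]) auto
  finally have "Re (poly h 0) \<le> 1 / (2 * pi) * integral {0..2 * pi} (\<lambda>\<theta>. g (cis \<theta>)) + e / 2"
    by (simp add: field_simps)
  with 1 show "ln (cmod (f 0)) \<le> 1 / (2 * pi) * integral {0..2 * pi} (\<lambda>\<theta>. g (cis \<theta>)) + e"
    by linarith
qed

subsection \<open>Locally uniform limits\<close>

text \<open>The normalised increments are at most K / (4 d) * 2^(-n), so the telescoping series
  passes the Weierstrass test near each point. Taking the pointwise \<open>lim\<close> as the limit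
  makes the local limits agree globally.\<close>

lemma locally_uniform_limit_four_power:
  fixes L :: "nat \<Rightarrow> 'a::topological_space \<Rightarrow> real"
  assumes d: "0 < d"
    and bound: "\<And>x. x \<in> U \<Longrightarrow> \<exists>K. \<forall>\<^sub>F y in nhds x. \<forall>n. \<bar>L (Suc n) y - 4 * L n y\<bar> \<le> K * 2 ^ n"
  shows "locally_uniform_limit U (\<lambda>n y. L n y / (4 ^ n * d)) (\<lambda>y. lim (\<lambda>n. L n y / (4 ^ n * d)))"
  unfolding locally_uniform_limit_def
proof
  fix x assume "x \<in> U"
  then obtain K V where V: "open V" "x \<in> V"
    and K: "\<And>y n. y \<in> V \<Longrightarrow> \<bar>L (Suc n) y - 4 * L n y\<bar> \<le> K * 2 ^ n"
    using bound unfolding eventually_nhds by metis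
  define u where "u n y = L n y / (4 ^ n * d)" for n y
  have step: "norm (u (Suc n) y - u n y) \<le> K / (4 * d) * (1 / 2) ^ n" if "y \<in> V" for n y
  proof -
    have "u (Suc n) y - u n y = (L (Suc n) y - 4 * L n y) / (4 ^ Suc n * d)"
      using d by (simp add: u_def field_simps)
    then have "norm (u (Suc n) y - u n y) = \<bar>L (Suc n) y - 4 * L n y\<bar> / (4 ^ Suc n * d)"
      using d by (simp add: abs_mult)
    also have "\<dots> \<le> K * 2 ^ n / (4 ^ Suc n * d)"
      using K[OF that] d by (intro divide_right_mono) auto
    also have "(4::real) ^ n = 2 ^ n * 2 ^ n"
      by (simp add: power_mult_distrib[symmetric])
    then have "K * 2 ^ n / (4 ^ Suc n * d) = K / (4 * d) * (1 / 2) ^ n"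
      using d by (simp add: field_simps)
    finally show ?thesis .
  qed
  have "uniformly_convergent_on V (\<lambda>n y. \<Sum>i<n. u (Suc i) y - u i y)"
    by (rule Weierstrass_m_test'[OF step]) (auto intro!: summable_mult summable_geometric)
  then obtain l where "uniform_limit V (\<lambda>n y. \<Sum>i<n. u (Suc i) y - u i y) l sequentially"
    unfolding uniformly_convergent_on_def by blast
  from uniform_limit_add[OF uniform_limit_const this, of "u 0"]
  have "uniformly_convergent_on V (\<lambda>n y. u 0 y + (\<Sum>i<n. u (Suc i) y - u i y))"
    unfolding uniformly_convergent_on_def by blast
  moreover have "u 0 y + (\<Sum>i<n. u (Suc i) y - u i y) = u n y" for n y
    using sum_lessThan_telescope[of "\<lambda>i. u i y" n] by simp
  ultimately have "uniformly_convergent_on V u" by simp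
  then have "uniform_limit V u (\<lambda>y. lim (\<lambda>n. u n y)) sequentially"
    by (simp only: uniformly_convergent_uniform_limit_iff)
  then have "uniform_limit (V \<inter> U) u (\<lambda>y. lim (\<lambda>n. u n y)) sequentially"
    by (rule uniform_limit_on_subset) simp
  then show "\<exists>V. open V \<and> x \<in> V \<and> uniform_limit (V \<inter> U) (\<lambda>n y. L n y / (4 ^ n * d))
      (\<lambda>y. lim (\<lambda>n. L n y / (4 ^ n * d))) sequentially"
    using V unfolding u_def[abs_def] by blast
qed

lemma continuous_on_locally_uniform_limit:
  fixes f :: "nat \<Rightarrow> 'a::t2_space \<Rightarrow> real"
  assumes "open U" and lim: "locally_uniform_limit U f g" and cont: "\<And>n. continuous_on U (f n)"
  shows "continuous_on U g"
  unfolding continuous_on_eq_continuous_at[OF \<open>open U\<close>]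
proof
  fix x assume "x \<in> U"
  then obtain V where V: "open V" "x \<in> V" "uniform_limit (V \<inter> U) f g sequentially"
    using lim by (auto simp: locally_uniform_limit_def)
  have "continuous_on (V \<inter> U) g"
  proof (rule uniform_limit_theorem[OF _ V(3)])
    show "\<forall>\<^sub>F n in sequentially. continuous_on (V \<inter> U) (f n)"
      by (intro always_eventually allI continuous_on_subset[OF cont]) auto
  qed simp
  then show "isCont g x"
    using V \<open>x \<in> U\<close> \<open>open U\<close> by (metis IntI continuous_on_eq_continuous_at open_Int)
qed

lemma uniform_limit_compact:
  fixes f :: "nat \<Rightarrow> 'a::topological_space \<Rightarrow> real"
  assumes lim: "locally_uniform_limit U f g" and "compact S" and "S \<subseteq> U"
  shows "uniform_limit S f g sequentially"
proof -
  obtain V where V: "\<And>x. x \<in> S \<Longrightarrow> open (V x)" "\<And>x. x \<in> S \<Longrightarrow> x \<in> V x"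
    "\<And>x. x \<in> S \<Longrightarrow> uniform_limit (V x \<inter> U) f g sequentially"
    using lim \<open>S \<subseteq> U\<close> unfolding locally_uniform_limit_def by (metis subsetD)
  obtain I where I: "I \<subseteq> S" "finite I" "S \<subseteq> (\<Union>x\<in>I. V x)"
    using compactE_image[OF \<open>compact S\<close>, of S V] V by (metis UN_I subsetI)
  show ?thesis
  proof (rule uniform_limitI)
    fix e :: real assume "0 < e"
    then have "\<forall>\<^sub>F n in sequentially. \<forall>x\<in>I. \<forall>y\<in>V x \<inter> U. dist (f n y) (g y) < e"
      using I V(3) by (intro eventually_ball_finite) (auto dest!: uniform_limitD)
    then show "\<forall>\<^sub>F n in sequentially. \<forall>y\<in>S. dist (f n y) (g y) < e"
      by (rule eventually_mono) (use I \<open>S \<subseteq> U\<close> in blast)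
  qed
qed

text \<open>Uniform closeness on the disc lets the limit itself, shifted by e/2, majorise the n-th
  function on the circle. The sub-mean inequality is thus applied with the integral of G, and limit
  and integral are never interchanged.\<close>

lemma plurisubharmonic_on_lim:
  fixes p q :: "nat \<Rightarrow> complex \<times> complex \<Rightarrow> complex" and D :: "nat \<Rightarrow> real"
  assumes U: "open U"
    and lim: "locally_uniform_limit U (\<lambda>n x. ln (maxnorm (p n x, q n x)) / D n) G"
    and cont: "continuous_on U G" and D: "\<And>n. 0 < D n"
    and p: "\<And>n a b. (\<lambda>z. p n (a + (z * fst b, z * snd b))) holomorphic_on UNIV"
    and q: "\<And>n a b. (\<lambda>z. q n (a + (z * fst b, z * snd b))) holomorphic_on UNIV"
    and nz: "\<And>n x. x \<in> U \<Longrightarrow> (p n x, q n x) \<noteq> (0, 0)"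
  shows "plurisubharmonic_on U G"
  unfolding plurisubharmonic_on_def
proof (intro conjI allI impI)
  show "open U" by fact
  show "upper_semicontinuous_on U G"
    unfolding upper_semicontinuous_on_def
  proof (intro ballI allI impI)
    fix x c assume "x \<in> U" "G x < c"
    moreover have "(G \<longlongrightarrow> G x) (at x within U)"
      using cont \<open>x \<in> U\<close> by (simp add: continuous_on_def)
    ultimately show "\<forall>\<^sub>F y in at x within U. G y < c" using order_tendstoD(2) by blast
  qed
  fix a b
  assume disc: "\<forall>\<zeta>. cmod \<zeta> \<le> 1 \<longrightarrow> a + (\<zeta> * fst b, \<zeta> * snd b) \<in> U"
  define \<gamma> where "\<gamma> z = a + (z * fst b, z * snd b)" for z
  define u where "u n x = ln (maxnorm (p n x, q n x)) / D n" for n x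
  have \<gamma>U: "\<gamma> ` cball 0 1 \<subseteq> U" using disc by (auto simp: \<gamma>_def)
  have cont_\<gamma>: "continuous_on S \<gamma>" for S
    unfolding \<gamma>_def by (intro continuous_intros)
  have unif: "uniform_limit (\<gamma> ` cball 0 1) u G sequentially"
    unfolding u_def
    by (rule uniform_limit_compact[OF lim compact_continuous_image[OF cont_\<gamma> compact_cball] \<gamma>U])
  have contG: "continuous_on (sphere 0 1) (\<lambda>z. G (\<gamma> z))"
    by (rule continuous_on_compose2[OF cont cont_\<gamma>]) (use \<gamma>U in auto)
  have "continuous_on {0..2 * pi} (\<lambda>\<theta>. G (\<gamma> (cis \<theta>)))"
    by (rule continuous_on_compose2[OF contG]) (auto intro!: continuous_intros)
  then have Gi: "(\<lambda>\<theta>. G (\<gamma> (cis \<theta>))) integrable_on {0..2 * pi}"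
    by (rule integrable_continuous_interval)
  have "G a \<le> 1 / (2 * pi) * integral {0..2 * pi} (\<lambda>\<theta>. G (\<gamma> (cis \<theta>)))"
  proof (rule field_le_epsilon)
    fix e :: real assume "0 < e"
    then obtain n where n: "\<And>y. y \<in> \<gamma> ` cball 0 1 \<Longrightarrow> \<bar>u n y - G y\<bar> < e / 2"
      using uniform_limitD[OF unif, of "e / 2"] eventually_happens'[OF sequentially_bot]
      by (fastforce simp: dist_real_def)
    let ?g = "\<lambda>z. D n * (G (\<gamma> z) + e / 2)"
    have a: "\<gamma> 0 = a" by (simp add: \<gamma>_def zero_prod_def[symmetric])
    have a_in: "\<gamma> 0 \<in> \<gamma> ` cball 0 1" by simp
    have exp_u: "maxnorm (p n (\<gamma> z), q n (\<gamma> z)) = exp (D n * u n (\<gamma> z))" if "z \<in> cball 0 1" for z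
    proof -
      have "\<gamma> z \<in> U" using that \<gamma>U by blast
      then have "0 < maxnorm (p n (\<gamma> z), q n (\<gamma> z))" using nz by (simp only: maxnorm_pos_iff not_False_eq_True)
      then show ?thesis using D[of n] by (simp add: u_def)
    qed
    have le: "maxnorm (p n (\<gamma> z), q n (\<gamma> z)) \<le> exp (?g z)" if z: "z \<in> sphere 0 1" for z
    proof -
      have "z \<in> cball 0 1" using z by simp
      then have "\<bar>u n (\<gamma> z) - G (\<gamma> z)\<bar> < e / 2" by (intro n imageI)
      then have "u n (\<gamma> z) \<le> G (\<gamma> z) + e / 2" by linarith
      then show ?thesis using exp_u[of z] z D[of n] by simp
    qed
    have contg: "continuous_on (sphere 0 1) ?g"
      by (intro continuous_intros contG)
    have "D n * u n a \<le> 1 / (2 * pi) * integral {0..2 * pi} (\<lambda>\<theta>. ?g (cis \<theta>))"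
    proof -
      have Du: "D n * u n a = ln (maxnorm (p n a, q n a))" using D[of n] by (simp add: u_def)
      have "0 < maxnorm (p n a, q n a)"
        using nz[of a n] \<gamma>U a a_in by (auto simp: maxnorm_pos_iff)
      \<comment> \<open>One coordinate attains the maximum at the centre. On the circle that
        coordinate is at most the maximum, hence below the same majorant.\<close>
      then consider "maxnorm (p n a, q n a) = cmod (p n a)" "p n a \<noteq> 0"
        | "maxnorm (p n a, q n a) = cmod (q n a)" "q n a \<noteq> 0"
        by (auto simp: maxnorm_def max_def split: if_splits)
      then show ?thesis
      proof cases
        case 1
        have "ln (cmod (p n (\<gamma> 0))) \<le> 1 / (2 * pi) * integral {0..2 * pi} (\<lambda>\<theta>. ?g (cis \<theta>))"
        proof (rule ln_cmod_le_circle_mean[OF _ contg])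
          show "(\<lambda>z. p n (\<gamma> z)) holomorphic_on UNIV" unfolding \<gamma>_def by (rule p)
          show "cmod (p n (\<gamma> z)) \<le> exp (?g z)" if "z \<in> sphere 0 1" for z
            using le[OF that] cmod_le_maxnorm(1)[of "(p n (\<gamma> z), q n (\<gamma> z))"] by simp
        qed (use 1 a in simp)
        then show ?thesis using 1 a Du by simp
      next
        case 2
        have "ln (cmod (q n (\<gamma> 0))) \<le> 1 / (2 * pi) * integral {0..2 * pi} (\<lambda>\<theta>. ?g (cis \<theta>))"
        proof (rule ln_cmod_le_circle_mean[OF _ contg])
          show "(\<lambda>z. q n (\<gamma> z)) holomorphic_on UNIV" unfolding \<gamma>_def by (rule q)
          show "cmod (q n (\<gamma> z)) \<le> exp (?g z)" if "z \<in> sphere 0 1" for z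
            using le[OF that] cmod_le_maxnorm(2)[of "(p n (\<gamma> z), q n (\<gamma> z))"] by simp
        qed (use 2 a in simp)
        then show ?thesis using 2 a Du by simp
      qed
    qed
    also have "integral {0..2 * pi} (\<lambda>\<theta>. ?g (cis \<theta>)) =
        D n * (integral {0..2 * pi} (\<lambda>\<theta>. G (\<gamma> (cis \<theta>))) + 2 * pi * (e / 2))"
      by (subst integral_mult_right, subst integral_add[OF Gi]) auto
    also have "1 / (2 * pi) * \<dots> = D n * (1 / (2 * pi) * integral {0..2 * pi} (\<lambda>\<theta>. G (\<gamma> (cis \<theta>))) + e / 2)"
      by (simp add: field_simps)
    finally have "u n a \<le> 1 / (2 * pi) * integral {0..2 * pi} (\<lambda>\<theta>. G (\<gamma> (cis \<theta>))) + e / 2"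
      using D[of n] by (simp only: mult_le_cancel_left_pos)
    then show "G a \<le> 1 / (2 * pi) * integral {0..2 * pi} (\<lambda>\<theta>. G (\<gamma> (cis \<theta>))) + e"
      using n[OF a_in] unfolding a by linarith
  qed
  then show "G a \<le> 1 / (2 * pi) * integral {0..2 * pi} (\<lambda>\<theta>. G (a + (cis \<theta> * fst b, cis \<theta> * snd b)))"
    by (simp add: \<gamma>_def)
qed

lemma continuous_on_eval2 [continuous_intros]:
  "continuous_on S f \<Longrightarrow> continuous_on S g \<Longrightarrow> continuous_on S (\<lambda>x. eval2 P (f x) (g x))"
  unfolding eval2_altdef by (intro continuous_intros)

lemma holomorphic_on_eval2 [holomorphic_intros]:
  "f holomorphic_on S \<Longrightarrow> g holomorphic_on S \<Longrightarrow> (\<lambda>x. eval2 P (f x) (g x)) holomorphic_on S"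
  unfolding eval2_altdef by (intro holomorphic_intros)

text \<open>Homogeneous form of f_{1-t}(1 - x) = 1 - f_t(x). The representative (z - w, -w) of 1 - x
  makes this an exact conjugacy; (w - z, w) would produce a sign.\<close>

lemma lattes_map_one_minus:
  "lattes_map (1 - t) (fst X - snd X, - snd X) =
    (fst (lattes_map t X) - snd (lattes_map t X), - snd (lattes_map t X))"
  unfolding lattes_map_def prod.inject fst_conv snd_conv by algebra

text \<open>Supplies the initial cone condition of \<open>degenerate_orbit_bound\<close> with one
  \<rho> for a whole neighbourhood. The choice of \<rho> makes the inequality strict at x, which is
  then an open condition.\<close>

lemma eventually_scaled_le_cmod:
  fixes p :: "'a::t2_space \<Rightarrow> complex" and N :: "'a \<Rightarrow> real"
  assumes "isCont p x" and "isCont N x" and "p x \<noteq> 0"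
  shows "\<exists>\<rho>>0. \<rho> \<le> 1 \<and> (\<forall>\<^sub>F y in nhds x. \<rho> * N y \<le> cmod (p y))"
proof -
  define \<rho> where "\<rho> = min 1 (cmod (p x) / (2 * (\<bar>N x\<bar> + 1)))"
  have \<rho>: "0 < \<rho>" "\<rho> \<le> 1" using assms(3) by (auto simp: \<rho>_def)
  have "\<rho> * N x \<le> \<rho> * (\<bar>N x\<bar> + 1)" using \<rho> by (intro mult_left_mono) auto
  also have "\<dots> \<le> cmod (p x) / (2 * (\<bar>N x\<bar> + 1)) * (\<bar>N x\<bar> + 1)"
    by (intro mult_right_mono) (auto simp: \<rho>_def)
  also have "\<dots> = cmod (p x) / 2"
    using abs_ge_zero[of "N x"] by (simp add: field_simps add_nonneg_eq_0_iff)
  also have "\<dots> < cmod (p x)" using assms(3) by simp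
  finally have "\<rho> * N x < cmod (p x)" .
  moreover define h where "h y = cmod (p y) - \<rho> * N y" for y
  moreover have "isCont h x"
    unfolding h_def using assms by (intro continuous_intros)
  ultimately have "(h \<longlongrightarrow> h x) (nhds x)" "0 < h x"
    unfolding isCont_def tendsto_at_iff_tendsto_nhds by auto
  then have "\<forall>\<^sub>F y in nhds x. 0 < h y" by (rule order_tendstoD(1))
  then have "\<forall>\<^sub>F y in nhds x. \<rho> * N y \<le> cmod (p y)"
    by (rule eventually_mono) (simp add: h_def)
  with \<rho> show ?thesis by blast
qed

subsection \<open>Local control of the orbit\<close>

lemma maxnorm_shear:
  "maxnorm (z - w, - w) \<le> 2 * maxnorm (z, w)" "maxnorm (z, w) \<le> 2 * maxnorm (z - w, - w)"
proof -
  have "cmod (z - w) \<le> cmod z + cmod w" "cmod z \<le> cmod (z - w) + cmod w"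
    using norm_triangle_ineq4[of z w] norm_triangle_ineq[of "z - w" w] by simp_all
  then show "maxnorm (z - w, - w) \<le> 2 * maxnorm (z, w)" "maxnorm (z, w) \<le> 2 * maxnorm (z - w, - w)"
    by (auto simp: maxnorm_def)
qed

lemma ln_maxnorm_shear:
  assumes "(z, w) \<noteq> (0, 0)"
  shows "\<bar>ln (maxnorm (z, w)) - ln (maxnorm (z - w, - w))\<bar> \<le> ln 2"
proof -
  have pos: "0 < maxnorm (z, w)" "0 < maxnorm (z - w, - w)"
    using assms by (auto simp: maxnorm_pos_iff)
  have "ln (maxnorm (z - w, - w)) \<le> ln (2 * maxnorm (z, w))"
    "ln (maxnorm (z, w)) \<le> ln (2 * maxnorm (z - w, - w))"
    using pos maxnorm_shear by (intro ln_mono; simp)+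
  then show ?thesis using pos by (simp add: ln_mult abs_le_iff)
qed

text \<open>The n-th pair is (z n, t2 * e n). Only its recursion and its behaviour at the start are
  retained: \<open>z_0\<close> concerns t = 0 and t = infinity, \<open>shear_0\<close> concerns t =
  1, and \<open>common_0\<close> says that the first pair has no zero off the origin.\<close>

locale lattes_orbit =
  fixes z e :: "nat \<Rightarrow> bipoly"
  assumes z_Suc: "z (Suc n) = (var_t1 * var_t2 * (e n)\<^sup>2 - (z n)\<^sup>2)\<^sup>2"
    and e_Suc: "e (Suc n) = 4 * z n * e n * (var_t2 * e n - z n) * (var_t1 * e n - z n)"
    and z_0: "b \<noteq> 0 \<Longrightarrow> eval2 (z 0) 0 b \<noteq> 0" "a \<noteq> 0 \<Longrightarrow> eval2 (z 0) a 0 \<noteq> 0"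
    and shear_0: "a \<noteq> 0 \<Longrightarrow> eval2 (var_t2 * e 0 - z 0) a a \<noteq> 0"
    and common_0: "(a, b) \<noteq> (0, 0) \<Longrightarrow> eval2 (z 0) a b \<noteq> 0 \<or> eval2 (var_t2 * e 0) a b \<noteq> 0"
begin

definition orb :: "nat \<Rightarrow> complex \<times> complex \<Rightarrow> complex \<times> complex" where
  "orb n y = (eval2 (z n) (fst y) (snd y), snd y * eval2 (e n) (fst y) (snd y))"

text \<open>With t = t1 / t2 the second coordinate t1 * e is t times that of \<open>orb\<close>, so
  this is the orbit in the coordinate x / t. Being polynomial, it extends to t2 = 0, where it
  follows \<open>lattes_map 0\<close>.\<close>

definition orb_inf :: "nat \<Rightarrow> complex \<times> complex \<Rightarrow> complex \<times> complex" where
  "orb_inf n y = (eval2 (z n) (fst y) (snd y), fst y * eval2 (e n) (fst y) (snd y))"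

lemma orb_Suc: "snd y \<noteq> 0 \<Longrightarrow> orb (Suc n) y = lattes_map (fst y / snd y) (orb n y)"
  by (simp add: orb_def lattes_map_def z_Suc e_Suc field_simps power2_eq_square)

lemma orb_inf_Suc: "fst y \<noteq> 0 \<Longrightarrow> orb_inf (Suc n) y = lattes_map (snd y / fst y) (orb_inf n y)"
  by (simp add: orb_inf_def lattes_map_def z_Suc e_Suc field_simps power2_eq_square)

lemma orb_0_nonzero: "y \<noteq> (0, 0) \<Longrightarrow> orb 0 y \<noteq> (0, 0)"
  using common_0[of "fst y" "snd y"] by (auto simp: orb_def prod_eq_iff)

lemma isCont_eval2 [continuous_intros]:
  "isCont f x \<Longrightarrow> isCont g x \<Longrightarrow> isCont (\<lambda>x. eval2 P (f x) (g x)) x" for f g :: "complex \<times> complex \<Rightarrow> complex"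
  unfolding eval2_altdef by (intro continuous_intros)

lemma isCont_orb [continuous_intros]: "isCont (orb n) x" and isCont_orb_inf [continuous_intros]: "isCont (orb_inf n) x"
  unfolding orb_def orb_inf_def by (intro continuous_intros)+

lemma isCont_maxnorm [continuous_intros]: "isCont f x \<Longrightarrow> isCont (\<lambda>y. maxnorm (f y)) x"
  for f :: "complex \<times> complex \<Rightarrow> complex \<times> complex"
  unfolding maxnorm_def by (intro continuous_intros)

text \<open>The local hypothesis of \<open>locally_uniform_limit_four_power\<close>, joined with
  nonvanishing so that no logarithm takes its default value at 0.\<close>

definition controlled_at :: "complex \<times> complex \<Rightarrow> bool" where
  "controlled_at x \<longleftrightarrow> (\<exists>K. \<forall>\<^sub>F y in nhds x. \<forall>n. orb n y \<noteq> (0, 0) \<and>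
     \<bar>ln (maxnorm (orb (Suc n) y)) - 4 * ln (maxnorm (orb n y))\<bar> \<le> K * 2 ^ n)"

lemma eventually_param:
  fixes a b :: complex
  assumes "b \<noteq> 0" and "\<forall>\<^sub>F t in nhds (a / b). P t"
  shows "\<forall>\<^sub>F y in nhds (a, b). snd y \<noteq> 0 \<and> P (fst y / snd y)"
proof (rule eventually_conj)
  have lim: "((\<lambda>y::complex \<times> complex. snd y) \<longlongrightarrow> b) (nhds (a, b))"
    "((\<lambda>y::complex \<times> complex. fst y) \<longlongrightarrow> a) (nhds (a, b))"
    using tendsto_snd[OF filterlim_ident[of "nhds (a, b)"]] tendsto_fst[OF filterlim_ident[of "nhds (a, b)"]]
    by simp_all
  show "\<forall>\<^sub>F y in nhds (a, b). snd y \<noteq> 0"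
    using lim(1) assms(1) by (rule tendsto_imp_eventually_ne)
  have "((\<lambda>y. fst y / snd y) \<longlongrightarrow> a / b) (nhds (a, b))"
    using lim assms(1) by (intro tendsto_divide)
  then show "\<forall>\<^sub>F y in nhds (a, b). P (fst y / snd y)"
    using assms(2) by (simp add: filterlim_iff)
qed

lemma eventually_small: "\<forall>\<^sub>F t in nhds t0. cmod (t - t0) \<le> 1 / 16"
proof -
  have "\<forall>\<^sub>F t in nhds t0. dist t t0 < 1 / 16" by (rule eventually_nhds_metric[THEN iffD2]) (auto intro!: exI[of _ "1/16"])
  then show ?thesis by (rule eventually_mono) (simp add: dist_norm)
qed

lemma controlled_nondegenerate:
  assumes "b \<noteq> 0" and "a \<noteq> 0" and "a \<noteq> b"
  shows "controlled_at (a, b)"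
proof -
  have "a / b \<noteq> 0" "a / b \<noteq> 1" using assms by auto
  then obtain K where K: "\<forall>\<^sub>F t in nhds (a / b). \<forall>V. V \<noteq> (0, 0) \<longrightarrow> lattes_map t V \<noteq> (0, 0) \<and>
      \<bar>ln (maxnorm (lattes_map t V)) - 4 * ln (maxnorm V)\<bar> \<le> K"
    using nondegenerate_bound by blast
  have "\<forall>\<^sub>F y in nhds (a, b). \<forall>n. orb n y \<noteq> (0, 0) \<and>
     \<bar>ln (maxnorm (orb (Suc n) y)) - 4 * ln (maxnorm (orb n y))\<bar> \<le> K * 2 ^ n"
    using eventually_param[OF assms(1) K]
  proof (rule eventually_mono)
    fix y assume y: "snd y \<noteq> 0 \<and> (\<forall>V. V \<noteq> (0, 0) \<longrightarrow> lattes_map (fst y / snd y) V \<noteq> (0, 0) \<and>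
      \<bar>ln (maxnorm (lattes_map (fst y / snd y) V)) - 4 * ln (maxnorm V)\<bar> \<le> K)"
    have nz: "orb n y \<noteq> (0, 0)" for n
    proof (induction n)
      case 0
      show ?case using y by (intro orb_0_nonzero) auto
    next
      case (Suc n)
      then show ?case using y orb_Suc by metis
    qed
    have le: "\<bar>ln (maxnorm (orb (Suc n) y)) - 4 * ln (maxnorm (orb n y))\<bar> \<le> K" for n
      using y nz[of n] orb_Suc by metis
    have "0 \<le> K" using le[of 0] abs_ge_zero order_trans by blast
    then have "K \<le> K * 2 ^ n" for n by (simp add: mult_le_cancel_left1)
    then show "\<forall>n. orb n y \<noteq> (0, 0) \<and>
      \<bar>ln (maxnorm (orb (Suc n) y)) - 4 * ln (maxnorm (orb n y))\<bar> \<le> K * 2 ^ n"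
      using le nz order_trans by blast
  qed
  then show ?thesis unfolding controlled_at_def by blast
qed

lemma controlled_zero:
  assumes "b \<noteq> 0"
  shows "controlled_at (0, b)"
proof -
  have "fst (orb 0 (0, b)) \<noteq> 0" using z_0(1)[OF assms] by (simp add: orb_def)
  then have cone: "\<exists>\<rho>>0. \<rho> \<le> 1 \<and> (\<forall>\<^sub>F y in nhds (0, b). \<rho> * maxnorm (orb 0 y) \<le> cmod (fst (orb 0 y)))"
    by (intro eventually_scaled_le_cmod continuous_intros)
  obtain \<rho> where \<rho>: "0 < \<rho>" "\<rho> \<le> 1" "\<forall>\<^sub>F y in nhds (0, b). \<rho> * maxnorm (orb 0 y) \<le> cmod (fst (orb 0 y))"
    using cone by blast
  have "\<forall>\<^sub>F y in nhds (0, b). snd y \<noteq> 0 \<and> cmod (fst y / snd y - 0) \<le> 1 / 16"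
    using eventually_param[OF assms, where a = 0] eventually_small[of 0] by simp
  moreover note \<rho>(3)
  ultimately have "\<forall>\<^sub>F y in nhds (0, b). \<forall>n. orb n y \<noteq> (0, 0) \<and>
     \<bar>ln (maxnorm (orb (Suc n) y)) - 4 * ln (maxnorm (orb n y))\<bar> \<le> (2 * ln (4096 / \<rho>\<^sup>2) + ln 32) * 2 ^ n"
  proof eventually_elim
    case (elim y)
    then have "orb 0 y \<noteq> (0, 0)" by (intro orb_0_nonzero) auto
    with elim degenerate_orbit_bound[of "fst y / snd y" "\<lambda>n. orb n y" \<rho>] \<rho>(1,2) show ?case
      by (simp add: orb_Suc)
  qed
  then show ?thesis unfolding controlled_at_def by blast
qed

lemma controlled_one:
  assumes "b \<noteq> 0"
  shows "controlled_at (b, b)"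
proof -
  define Y where "Y n y = (fst (orb n y) - snd (orb n y), - snd (orb n y))" for n y
  have "fst (Y 0 (b, b)) \<noteq> 0" using shear_0[OF assms] by (simp add: Y_def orb_def)
  moreover have "isCont (Y 0) (b, b)" unfolding Y_def by (intro continuous_intros)
  ultimately have cone: "\<exists>\<rho>>0. \<rho> \<le> 1 \<and> (\<forall>\<^sub>F y in nhds (b, b). \<rho> * maxnorm (Y 0 y) \<le> cmod (fst (Y 0 y)))"
    by (intro eventually_scaled_le_cmod continuous_intros)
  obtain \<rho> where \<rho>: "0 < \<rho>" "\<rho> \<le> 1" "\<forall>\<^sub>F y in nhds (b, b). \<rho> * maxnorm (Y 0 y) \<le> cmod (fst (Y 0 y))"
    using cone by blast
  define K where "K = 2 * ln (4096 / \<rho>\<^sup>2) + ln 32"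
  have "\<forall>\<^sub>F y in nhds (b, b). snd y \<noteq> 0 \<and> cmod (fst y / snd y - 1) \<le> 1 / 16"
    using eventually_param[OF assms, where a = b] eventually_small[of 1] assms by simp
  moreover note \<rho>(3)
  ultimately have "\<forall>\<^sub>F y in nhds (b, b). \<forall>n. orb n y \<noteq> (0, 0) \<and>
     \<bar>ln (maxnorm (orb (Suc n) y)) - 4 * ln (maxnorm (orb n y))\<bar> \<le> (K + 5 * ln 2) * 2 ^ n"
  proof eventually_elim
    case (elim y)
    let ?t = "1 - fst y / snd y"
    have t: "cmod ?t \<le> 1 / 16" using elim by (simp add: norm_minus_commute)
    have Y_Suc: "Y (Suc n) y = lattes_map ?t (Y n y)" for n
      using elim by (simp add: Y_def orb_Suc lattes_map_one_minus)
    have "orb 0 y \<noteq> (0, 0)" using elim by (intro orb_0_nonzero) auto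
    then have "Y 0 y \<noteq> (0, 0)" by (auto simp: Y_def prod_eq_iff)
    then have Y: "Y n y \<noteq> (0, 0)"
      "\<bar>ln (maxnorm (Y (Suc n) y)) - 4 * ln (maxnorm (Y n y))\<bar> \<le> K * 2 ^ n" for n
      using degenerate_orbit_bound(1,2)[of ?t "\<lambda>n. Y n y" \<rho>] t Y_Suc \<rho>(1,2) elim by (simp_all add: K_def)
    have nz: "orb n y \<noteq> (0, 0)" for n using Y(1)[of n] by (auto simp: Y_def)
    then have XY: "\<bar>ln (maxnorm (orb n y)) - ln (maxnorm (Y n y))\<bar> \<le> ln 2" for n
      unfolding Y_def using ln_maxnorm_shear[of "fst (orb n y)" "snd (orb n y)"] by simp
    have "\<bar>ln (maxnorm (orb (Suc n) y)) - 4 * ln (maxnorm (orb n y))\<bar> \<le> (K + 5 * ln 2) * 2 ^ n" for n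
    proof -
      \<comment> \<open>The factor 5 is 1 + 4: one shear error at \<open>Suc n\<close> and four at
        \<open>n\<close>.\<close>
      have "\<bar>ln (maxnorm (orb (Suc n) y)) - 4 * ln (maxnorm (orb n y))\<bar> \<le> K * 2 ^ n + 5 * ln 2"
        using XY[of n] XY[of "Suc n"] Y(2)[of n] by linarith
      also have "\<dots> \<le> K * 2 ^ n + 5 * ln 2 * 2 ^ n"
        by (intro add_left_mono) (simp add: mult_le_cancel_left1)
      finally show ?thesis by (simp add: algebra_simps)
    qed
    with nz show ?case by blast
  qed
  then show ?thesis unfolding controlled_at_def by blast
qed

text \<open>Over \<open>t2 = 0\<close> the symmetry \<open>(t, z) \<mapsto> (1 / t, z / t)\<close> reduces to parameters near \<open>0\<close>.
  Here \<open>orb\<close> and \<open>orb_inf\<close> are not comparable up to a constant, but up to a loss growing like \<open>2 ^ n\<close>.\<close>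
lemma controlled_infinity:
  assumes "a \<noteq> 0"
  shows "controlled_at (a, 0)"
proof -
  have "fst (orb_inf 0 (a, 0)) \<noteq> 0" using z_0(2)[OF assms] by (simp add: orb_inf_def)
  then have cone: "\<exists>\<rho>>0. \<rho> \<le> 1 \<and> (\<forall>\<^sub>F y in nhds (a, 0). \<rho> * maxnorm (orb_inf 0 y) \<le> cmod (fst (orb_inf 0 y)))"
    by (intro eventually_scaled_le_cmod continuous_intros)
  obtain \<rho> where \<rho>: "0 < \<rho>" "\<rho> \<le> 1" "\<forall>\<^sub>F y in nhds (a, 0). \<rho> * maxnorm (orb_inf 0 y) \<le> cmod (fst (orb_inf 0 y))"
    using cone by blast
  define K where "K = 2 * ln (4096 / \<rho>\<^sup>2) + ln 32"
  have fst_lim: "((\<lambda>y::complex \<times> complex. fst y) \<longlongrightarrow> a) (nhds (a, 0))"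
    and snd_lim: "((\<lambda>y::complex \<times> complex. snd y) \<longlongrightarrow> 0) (nhds (a, 0))"
    using tendsto_snd[OF filterlim_ident[of "nhds (a, 0)"]] tendsto_fst[OF filterlim_ident[of "nhds (a, 0)"]]
    by simp_all
  have param_lim: "((\<lambda>y::complex \<times> complex. snd y / fst y) \<longlongrightarrow> 0) (nhds (a, 0))"
    using tendsto_divide[OF snd_lim fst_lim assms] by simp
  have "\<forall>\<^sub>F y in nhds (a, 0 :: complex). fst y \<noteq> 0"
    using tendsto_imp_eventually_ne[OF fst_lim assms] .
  moreover have "\<forall>\<^sub>F y in nhds (a, 0 :: complex). cmod (snd y / fst y - 0) \<le> 1 / 16"
    using param_lim eventually_small[of 0] by (rule eventually_compose_filterlim[rotated])
  ultimately have "\<forall>\<^sub>F y in nhds (a, 0). \<forall>n. orb n y \<noteq> (0, 0) \<and>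
     \<bar>ln (maxnorm (orb (Suc n) y)) - 4 * ln (maxnorm (orb n y))\<bar> \<le> (7 * K) * 2 ^ n"
    using \<rho>(3)
  proof eventually_elim
    case (elim y)
    let ?t = "snd y / fst y"
    have t: "cmod ?t \<le> 1 / 16" using elim by simp
    have "y \<noteq> (0, 0)" using elim by auto
    then have "orb_inf 0 y \<noteq> (0, 0)"
      using orb_0_nonzero[of y] elim by (auto simp: orb_def orb_inf_def)
    then have Y: "orb_inf n y \<noteq> (0, 0)"
      "\<bar>ln (maxnorm (orb_inf (Suc n) y)) - 4 * ln (maxnorm (orb_inf n y))\<bar> \<le> K * 2 ^ n"
      "0 < max (cmod (fst (orb_inf n y))) (cmod ?t * cmod (snd (orb_inf n y)))"
      "ln (maxnorm (orb_inf n y)) - K * 2 ^ n \<le> ln (max (cmod (fst (orb_inf n y))) (cmod ?t * cmod (snd (orb_inf n y))))" for n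
      using degenerate_orbit_bound[of ?t "\<lambda>n. orb_inf n y" \<rho> n] t orb_inf_Suc \<rho>(1,2) elim
      by (auto simp: K_def)
    \<comment> \<open>The norm of \<open>orb\<close> is exactly the weighted maximum that the last
      two parts of \<open>degenerate_orbit_bound\<close> control, including the case t2 = 0.\<close>
    have orb_eq: "maxnorm (orb n y) = max (cmod (fst (orb_inf n y))) (cmod ?t * cmod (snd (orb_inf n y)))" for n
      using elim by (simp add: maxnorm_def orb_def orb_inf_def norm_mult norm_divide)
    have "cmod ?t * cmod (snd (orb_inf n y)) \<le> cmod (snd (orb_inf n y))" for n
      using t by (intro mult_left_le_one_le) auto
    then have "maxnorm (orb n y) \<le> maxnorm (orb_inf n y)" for n
      unfolding orb_eq unfolding maxnorm_def by (rule max.mono[OF order_refl])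
    moreover have orb_pos: "0 < maxnorm (orb n y)" for n
      unfolding orb_eq by (rule Y(3))
    ultimately have up: "ln (maxnorm (orb n y)) \<le> ln (maxnorm (orb_inf n y))" for n
      by (meson ln_mono)
    have low: "ln (maxnorm (orb_inf n y)) - K * 2 ^ n \<le> ln (maxnorm (orb n y))" for n
      unfolding orb_eq by (rule Y(4))
    \<comment> \<open>The factor 7 is 1 + 2 + 4: the step of \<open>orb_inf\<close>, the comparison
      loss at \<open>Suc n\<close>, and four times that at \<open>n\<close>.\<close>
    have "\<bar>ln (maxnorm (orb (Suc n) y)) - 4 * ln (maxnorm (orb n y))\<bar> \<le> (7 * K) * 2 ^ n" for n
      using up[of n] up[of "Suc n"] low[of n] low[of "Suc n"] Y(2)[of n] by simp
    moreover have "orb n y \<noteq> (0, 0)" for n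
      using orb_pos[of n] unfolding maxnorm_pos_iff .
    ultimately show ?case by blast
  qed
  then show ?thesis unfolding controlled_at_def by blast
qed

lemma controlled: "x \<noteq> (0, 0) \<Longrightarrow> controlled_at x"
  using controlled_nondegenerate controlled_zero controlled_one controlled_infinity
  by (cases x) (metis (full_types))

end

section \<open>Passage from the lift to the orbit, and conclusion\<close>

lemma lattes_orbit_exists:
  assumes "c \<noteq> 0" and "c \<noteq> 1" and "c \<noteq> Fract [:0, 1:] 1" and "homogeneous_lift c C"
  obtains d z e where "0 < d" "lattes_orbit z e" "\<And>n. lattes_seq C n = (z n, var_t2 * e n)"
    "\<And>n. pair_deg (lattes_seq C n) = 4 ^ n * d"
proof -
  obtain d z0 w0 where F0: "lattes_seq C 0 = (z0, w0)" "homogeneous d z0" "homogeneous d w0"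
    "coprime z0 w0" "0 < d" "\<not> var_t1 dvd z0" "\<not> var_t2 - var_t1 dvd w0 - z0" "var_t2 dvd w0" "\<not> var_t2 dvd z0"
    using lattes_seq_0_properties[OF assms] by metis
  have hom: "homogeneous (4 ^ n * d) (fst (lattes_seq C n)) \<and> homogeneous (4 ^ n * d) (snd (lattes_seq C n))
    \<and> var_t2 dvd snd (lattes_seq C n)" for n
    using F0 by (intro lattes_seq_homogeneous) simp_all
  define z where "z n = fst (lattes_seq C n)" for n
  obtain e where "\<And>n. snd (lattes_seq C n) = var_t2 * e n"
    using hom unfolding dvd_def by metis
  then have seq: "lattes_seq C n = (z n, var_t2 * e n)" for n
    by (simp add: z_def prod_eq_iff)
  have t2: "var_t2 \<noteq> 0" by (simp add: var_t2_def)
  have z_Suc: "z (Suc n) = (var_t1 * var_t2 * (e n)\<^sup>2 - (z n)\<^sup>2)\<^sup>2"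
    and e_Suc: "e (Suc n) = 4 * z n * e n * (var_t2 * e n - z n) * (var_t1 * e n - z n)" for n
    using lattes_seq_step[OF seq[of n]] seq[of "Suc n"] t2 by (simp_all del: lattes_seq.simps)
  have z0: "z 0 = z0" and w0: "var_t2 * e 0 = w0"
    using seq[of 0] F0(1) by (simp_all del: lattes_seq.simps)
  have hz: "homogeneous (4 ^ n * d) (z n)" and hw: "homogeneous (4 ^ n * d) (var_t2 * e n)" for n
    using hom[of n] seq[of n] by (simp_all del: lattes_seq.simps)
  \<comment> \<open>Modulo t2 the recursion reads z' = z^4, so non-divisibility persists. Hence z n
    is nonzero and the degree of the pair is exactly \<open>4 ^ n * d\<close>.\<close>
  have nd: "\<not> var_t2 dvd z n" for n
  proof (induction n)
    case (Suc n)
    have "var_t2 dvd z n" if "var_t2 dvd z (Suc n)"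
    proof -
      have "var_t2 dvd var_t1 * var_t2 * (e n)\<^sup>2 - (z n)\<^sup>2"
        using that prime_elem_vars(2) unfolding z_Suc by (rule prime_elem_dvd_power[rotated])
      then have "var_t2 dvd (z n)\<^sup>2"
        using dvd_diff_right_iff[of var_t2 "var_t1 * var_t2 * (e n)\<^sup>2" "(z n)\<^sup>2"] by simp
      then show ?thesis using prime_elem_vars(2) prime_elem_dvd_power by blast
    qed
    with Suc show ?case by blast
  qed (use F0 z0 in simp)
  have "pair_deg (lattes_seq C n) = 4 ^ n * d" for n
  proof -
    have "z n \<noteq> 0" using nd[of n] by auto
    then have "total_degree (z n) = 4 ^ n * d" using hz total_degree_homogeneous by blast
    moreover have "total_degree (var_t2 * e n) \<le> 4 ^ n * d"
      using hw[of n] total_degree_homogeneous total_degree_0 by (cases "var_t2 * e n = 0") auto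
    ultimately show ?thesis by (simp add: pair_deg_def seq del: lattes_seq.simps)
  qed
  moreover have "lattes_orbit z e"
  proof
    show "eval2 (z 0) 0 b \<noteq> 0" if "b \<noteq> 0" for b
      using that F0(2,6) var_t1_dvd_homogeneous eval2_homogeneous[OF F0(2), of b 0 1]
      by (auto simp: z0)
    show "eval2 (z 0) a 0 \<noteq> 0" if "a \<noteq> 0" for a
      using that F0(2,9) line_dvd_homogeneous[OF F0(2), of 0] eval2_homogeneous[OF F0(2), of a 1 0]
      by (auto simp: z0 var_t2_def)
    have h: "homogeneous d (w0 - z0)" using F0(2,3) by (intro homogeneous_diff)
    show "eval2 (var_t2 * e 0 - z 0) a a \<noteq> 0" if "a \<noteq> 0" for a
      using that F0(7) line_dvd_homogeneous[OF h, of 1] eval2_homogeneous[OF h, of a 1 1]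
      unfolding z0 w0 by (auto simp: var_t1_def var_t2_def simp del: eval2_simps)
    show "eval2 (z 0) a b \<noteq> 0 \<or> eval2 (var_t2 * e 0) a b \<noteq> 0" if "(a, b) \<noteq> (0, 0)" for a b
      unfolding z0 w0 using F0(2,3,4) that by (rule coprime_homogeneous_no_common_zero)
  qed (fact z_Suc e_Suc)+
  ultimately show ?thesis using that F0(5) seq by blast
qed

theorem theorem1p5:
  fixes c :: "complex poly fract" and C :: "bipoly \<times> bipoly"
  assumes "c \<noteq> 0" and "c \<noteq> 1" and "c \<noteq> Fract [:0, 1:] 1"
    and "homogeneous_lift c C"
  shows "\<exists>G :: complex \<times> complex \<Rightarrow> real.
           locally_uniform_limit (UNIV - {(0, 0)})
             (\<lambda>n x. ln (maxnorm (pair_eval (lattes_seq C n) x)) / real (pair_deg (lattes_seq C n))) G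
         \<and> continuous_on (UNIV - {(0, 0)}) G
         \<and> plurisubharmonic_on (UNIV - {(0, 0)}) G"
proof -
  obtain d z e where d: "0 < d" and "lattes_orbit z e"
    and seq: "\<And>n. lattes_seq C n = (z n, var_t2 * e n)"
    and deg: "\<And>n. pair_deg (lattes_seq C n) = 4 ^ n * d"
    using lattes_orbit_exists[OF assms] by metis
  interpret lattes_orbit z e by fact
  let ?U = "UNIV - {(0, 0)} :: (complex \<times> complex) set"
  have eval: "pair_eval (lattes_seq C n) x = orb n x" for n x
    by (simp add: pair_eval_def orb_def seq del: lattes_seq.simps)
  \<comment> \<open>With the factor t2 absorbed, both coordinates are evaluations of polynomials,
    which gives holomorphy along every complex line.\<close>
  have orb_poly: "orb n x = (eval2 (z n) (fst x) (snd x), eval2 (var_t2 * e n) (fst x) (snd x))" for n x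
    by (simp add: orb_def)
  have ctl: "controlled_at x" if "x \<in> ?U" for x using that controlled by simp
  have nz: "orb n x \<noteq> (0, 0)" if "x \<in> ?U" for n x
    using ctl[OF that] eventually_nhds_x_imp_x unfolding controlled_at_def by blast
  have U: "open ?U" by (intro open_Diff open_UNIV closed_singleton)
  define G where "G y = lim (\<lambda>n. ln (maxnorm (orb n y)) / (4 ^ n * real d))" for y
  have lim: "locally_uniform_limit ?U (\<lambda>n y. ln (maxnorm (orb n y)) / (4 ^ n * real d)) G"
    unfolding G_def
  proof (rule locally_uniform_limit_four_power)
    fix x assume "x \<in> ?U"
    then obtain K where "\<forall>\<^sub>F y in nhds x. \<forall>n. orb n y \<noteq> (0, 0) \<and>
        \<bar>ln (maxnorm (orb (Suc n) y)) - 4 * ln (maxnorm (orb n y))\<bar> \<le> K * 2 ^ n"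
      using ctl unfolding controlled_at_def by blast
    then show "\<exists>K. \<forall>\<^sub>F y in nhds x. \<forall>n. \<bar>ln (maxnorm (orb (Suc n) y)) - 4 * ln (maxnorm (orb n y))\<bar> \<le> K * 2 ^ n"
      by (intro exI[of _ K]) (auto elim!: eventually_mono)
  qed (use d in simp)
  have cont: "continuous_on ?U G"
  proof (rule continuous_on_locally_uniform_limit[OF U lim])
    fix n
    have "maxnorm (orb n x) \<noteq> 0" if "x \<in> ?U" for x
      using nz[OF that, of n] maxnorm_pos_iff[of "orb n x"] by auto
    then show "continuous_on ?U (\<lambda>y. ln (maxnorm (orb n y)) / (4 ^ n * real d))"
      using d unfolding orb_def maxnorm_def by (intro continuous_intros) auto
  qed
  have "plurisubharmonic_on ?U G"
  proof (rule plurisubharmonic_on_lim[OF U _ cont])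
    show "locally_uniform_limit ?U (\<lambda>n x. ln (maxnorm (eval2 (z n) (fst x) (snd x),
        eval2 (var_t2 * e n) (fst x) (snd x))) / (4 ^ n * real d)) G"
      using lim unfolding orb_poly .
    show "(eval2 (z n) (fst x) (snd x), eval2 (var_t2 * e n) (fst x) (snd x)) \<noteq> (0, 0)" if "x \<in> ?U" for n x
      using nz[OF that] unfolding orb_poly .
  qed (use d in \<open>auto intro!: holomorphic_intros simp del: eval2_simps\<close>)
  moreover have "locally_uniform_limit ?U
      (\<lambda>n x. ln (maxnorm (pair_eval (lattes_seq C n) x)) / real (pair_deg (lattes_seq C n))) G"
    using lim unfolding eval deg by simp
  ultimately show ?thesis using cont by blast
qed

end
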